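(* For integers $n\ge j\ge 1$ and $m\ge 0$, the out-degree $Y_{n,j}$ of node $j$ in a random ordered increasing $k$-tree of size $n$ satisfies \[ \mathbb{P}\{Y_{n,j}=m\}=\frac{\binom{j-\frac{k}{k+1}}{j}}{\binom{n-\frac{k}{k+1}}{n}\binom{n}{j}}\sum_{\ell=0}^{m}\binom{m}{\ell}(-1)^{\ell}\binom{n-\frac{k(2+\ell)}{k+1}}{n-j}. \] Moreover, as $n\to\infty$: (i) For fixed $j\ge1$: $n^{-\frac{k}{k+1}}Y_{n,j}$ converges in distribution to a random variable $Y_j$ which is uniquely determined by its moments, these being $\mathbb{E}(Y_j^s)=\frac{s!\,\Gamma(j+\frac{1}{k+1})}{\Gamma(j+1+\frac{k(s-1)}{k+1})}$ for all integers $s\ge0$. (ii) If $j=j(n)\to\infty$ with $j=o(n)$: $(j/n)^{\frac{k}{k+1}}Y_{n,j}$ converges in distribution to an exponential random variable with parameter $1$ (whose $s$-th moment is $s!$). (iii) If $j=j(n)\to\infty$ with $j\sim\rho n$ for some fixed $0<\rho<1$: $Y_{n,j}$ converges in distribution to a random variable $Y_\rho$ with $\mathbb{P}\{Y_\rho=m\}=\rho^{\frac{k}{k+1}}(1-\rho^{\frac{k}{k+1}})^m$ for $m\ge0$ (geometric law). (iv) If $j=j(n)\to\infty$ with $n-j=o(n)$: $\mathbb{P}\{Y_{n,j}=0\}\to1$.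
   Context: Fix an integer $k\ge1$. An ordered increasing $k$-tree of size $n\ge0$ is built as follows. Start with the root-clique $K_0$: $k$ pairwise adjacent vertices labelled $0_1,\dots,0_k$ (the root nodes; each label $0_\ell$ has value $0$). For $j=1,\dots,n$ in turn, node $j$ is inserted by choosing a currently existing $k$-clique $K$ and attaching $j$ to it, i.e. adding edges from $j$ to all $k$ vertices of $K$; $j$ is then a child of $K$ and the vertices of $K$ are the parents of $j$. The $k$-cliques available for attachment are the root-clique and, for every previously inserted node $x$ attached to a clique $K'$, the $k$ cliques $\{x\}\cup(K'\setminus\{w\})$, $w\in K'$. The children of each $k$-clique are linearly ordered: if $K$ currently has $d^+(K)$ children, there are $d^+(K)+1$ positions at which the new child may be placed, and the choice of position is part of the structure. Thus there are $1+(k+1)(j-1)$ ways to insert node $j$, and distinct sequences of choices give distinct trees. A random ordered increasing $k$-tree of size $n$ is one chosen uniformly among all of them; equivalently, it is produced by the process in which node $n$ is attached to the clique $K$ with probability $\frac{d^+(K)+1}{1+(k+1)(n-1)}$ (and a uniformly random position among the $d^+(K)+1$). The out-degree of a node $u$ is the number of nodes having $u$ as a parent (for a root node this is its number of non-root neighbours). $Y_{n,j}$ denotes the out-degree of node $j$ in a random ordered increasing $k$-tree of size $n$. For real $x$ and integer $m\ge0$, $\binom{x}{m}=x(x-1)\cdots(x-m+1)/m!$, and $\binom{x}{m}=0$ for $m<0$. *)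

theory Defs
  imports "HOL-Probability.Probability"
begin

text \<open>Vertices of a k-tree: root nodes Root l (labels 0_1..0_k, l = 1..k) and inserted nodes Node j.\<close>
datatype vtx = Root nat | Node nat

definition root_clique :: "nat \<Rightarrow> vtx set" where
  "root_clique k = Root ` {1..k}"

text \<open>A tree of size n is encoded by the list t of insertion choices: t ! (i-1) = (K, p)
  means node i was attached to the k-clique K at position p (0..d^+(K)) among the
  children of K.\<close>
type_synonym ktree = "(vtx set \<times> nat) list"

definition avail :: "nat \<Rightarrow> ktree \<Rightarrow> nat \<Rightarrow> vtx set set" where
  "avail k t i = {root_clique k} \<union>
     (\<Union>x\<in>{1..<i}. (\<lambda>w. insert (Node x) (fst (t ! (x - 1)) - {w})) ` fst (t ! (x - 1)))"

definition nchildren :: "ktree \<Rightarrow> nat \<Rightarrow> vtx set \<Rightarrow> nat" where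
  "nchildren t i K = card {x\<in>{1..<i}. fst (t ! (x - 1)) = K}"

definition valid_tree :: "nat \<Rightarrow> nat \<Rightarrow> ktree \<Rightarrow> bool" where
  "valid_tree k n t \<longleftrightarrow> length t = n \<and>
     (\<forall>i\<in>{1..n}. fst (t ! (i - 1)) \<in> avail k t i \<and> snd (t ! (i - 1)) \<le> nchildren t i (fst (t ! (i - 1))))"

definition trees :: "nat \<Rightarrow> nat \<Rightarrow> ktree set" where
  "trees k n = {t. valid_tree k n t}"

definition outdeg :: "ktree \<Rightarrow> vtx \<Rightarrow> nat" where
  "outdeg t u = card {x\<in>{1..length t}. u \<in> fst (t ! (x - 1))}"

definition Y :: "nat \<Rightarrow> nat \<Rightarrow> nat \<Rightarrow> nat pmf" where
  "Y k n j = map_pmf (\<lambda>t. outdeg t (Node j)) (pmf_of_set (trees k n))"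

definition scaled_Y :: "nat \<Rightarrow> real \<Rightarrow> nat \<Rightarrow> nat \<Rightarrow> real measure" where
  "scaled_Y k c n j = measure_pmf (map_pmf (\<lambda>m. c * real m) (Y k n j))"

end

theory Submission
  imports Defs
begin

text \<open>
  When node \<open>j\<close> has out-degree \<open>d\<close>, the next node can be attached to it in \<open>k (d + 1)\<close> ways, so
  with \<open>c = k / (k + 1)\<close> the out-degree jumps from \<open>d\<close> to \<open>d + 1\<close> at time \<open>n\<close> with probability
  \<open>c (d + 1) / (n - c)\<close>. The recurrence for the probabilities is solved by the alternating sum, whose
  \<open>l\<close>-th term is a product of factors \<open>(i - c (2 + l)) / (i - c)\<close>, and the \<open>s\<close>-th rising factorial
  moment of \<open>Y + 1\<close> is \<open>s!\<close> times the product of the factors \<open>(i + c (s - 1)) / (i - c)\<close>, both for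
  \<open>j < i \<le> n\<close>. These products are quotients of Gamma values. If \<open>j\<close> is comparable to \<open>n\<close>, the
  probabilities themselves converge to geometric ones. Otherwise the scaling tends to 0, so rising
  factorial moments and moments have the same scaled limits, and the method of moments applies: the
  limiting moments grow at most like \<open>s!\<close>, hence they determine the distribution.
\<close>

section \<open>The out-degree as a Markov chain\<close>

text \<open>Availability at time \<open>i\<close> depends only on insertions with index below
  \<open>i\<close>. The bound \<open>Suc (length t)\<close> is the time of the next insertion, the
  last one at which the appended part is still invisible.\<close>

lemma avail_append: "i \<le> Suc (length t) \<Longrightarrow> avail k (t @ u) i = avail k t i"
  unfolding avail_def
  by (intro arg_cong2[where f="(\<union>)"] refl SUP_cong) (auto simp: nth_append)

lemma nchildren_append: "i \<le> Suc (length t) \<Longrightarrow> nchildren (t @ u) i K = nchildren t i K"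
  unfolding nchildren_def
  by (intro arg_cong[where f=card]) (auto simp: nth_append)

lemma avail_snoc:
  "avail k (t @ [(K, p)]) (Suc (Suc (length t))) =
     avail k t (Suc (length t)) \<union> (\<lambda>w. insert (Node (Suc (length t))) (K - {w})) ` K"
proof -
  have "{1..<Suc (Suc (length t))} = insert (Suc (length t)) {1..<Suc (length t)}"
    by auto
  then have "avail k (t @ [(K, p)]) (Suc (Suc (length t))) =
      avail k (t @ [(K, p)]) (Suc (length t)) \<union>
      (\<lambda>w. insert (Node (Suc (length t))) (K - {w})) ` K"
    unfolding avail_def by auto
  then show ?thesis
    by (simp add: avail_append)
qed

lemma nchildren_snoc:
  "nchildren (t @ [(K, p)]) (Suc (Suc (length t))) L =
     nchildren t (Suc (length t)) L + (if L = K then 1 else 0)"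
proof -
  let ?t = "t @ [(K, p)]" and ?n = "Suc (length t)"
  have "{x \<in> {1..<Suc ?n}. fst (?t ! (x - 1)) = L} =
      {x \<in> {1..<?n}. fst (?t ! (x - 1)) = L} \<union> (if L = K then {?n} else {})"
    by (auto simp: less_Suc_eq nth_append)
  then have "nchildren ?t (Suc ?n) L = nchildren ?t ?n L + (if L = K then 1 else 0)"
    unfolding nchildren_def by (simp only:) (subst card_Un_disjoint, auto)
  then show ?thesis
    by (simp add: nchildren_append)
qed

lemma outdeg_snoc: "outdeg (t @ [(K, p)]) v = outdeg t v + (if v \<in> K then 1 else 0)"
proof -
  let ?t = "t @ [(K, p)]" and ?n = "Suc (length t)"
  have "{x \<in> {1..length ?t}. v \<in> fst (?t ! (x - 1))} =
      {x \<in> {1..length t}. v \<in> fst (t ! (x - 1))} \<union> (if v \<in> K then {?n} else {})"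
    by (auto simp: le_Suc_eq nth_append)
  then show ?thesis
    unfolding outdeg_def by (simp only:) (subst card_Un_disjoint, auto)
qed

lemma valid_tree_snoc:
  "valid_tree k (Suc n) (t @ [(K, p)]) \<longleftrightarrow>
     valid_tree k n t \<and> K \<in> avail k t (Suc n) \<and> p \<le> nchildren t (Suc n) K"
proof (cases "length t = n")
  case True
  have "(\<forall>i\<in>{1..Suc n}. fst ((t @ [(K, p)]) ! (i - 1)) \<in> avail k (t @ [(K, p)]) i \<and>
          snd ((t @ [(K, p)]) ! (i - 1)) \<le> nchildren (t @ [(K, p)]) i (fst ((t @ [(K, p)]) ! (i - 1)))) \<longleftrightarrow>
     (\<forall>i\<in>{1..n}. fst (t ! (i - 1)) \<in> avail k t i \<and>
          snd (t ! (i - 1)) \<le> nchildren t i (fst (t ! (i - 1)))) \<and>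
     K \<in> avail k t (Suc n) \<and> p \<le> nchildren t (Suc n) K"
    (is "(\<forall>i\<in>_. ?P i) \<longleftrightarrow> (\<forall>i\<in>_. ?Q i) \<and> _")
  proof -
    have "{1..Suc n} = insert (Suc n) {1..n}"
      by auto
    moreover have "?P i \<longleftrightarrow> ?Q i" if "i \<in> {1..n}" for i
      using that True by (auto simp: nth_append avail_append nchildren_append)
    moreover have "?P (Suc n) \<longleftrightarrow> K \<in> avail k t (Suc n) \<and> p \<le> nchildren t (Suc n) K"
      using True by (auto simp: nth_append avail_append nchildren_append)
    ultimately show ?thesis
      by auto
  qed
  then show ?thesis
    using True unfolding valid_tree_def by simp
qed (auto simp: valid_tree_def)

lemma trees_0: "trees k 0 = {[]}"
  by (auto simp: trees_def valid_tree_def)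

text \<open>Splitting off the last insertion gives the recursion behind every count: first the old
  tree, then the clique, then the position.\<close>

lemma trees_Suc:
  "trees k (Suc n) = (\<lambda>(t, K, p). t @ [(K, p)]) `
     (SIGMA t:trees k n. SIGMA K:avail k t (Suc n). {..nchildren t (Suc n) K})"
proof -
  have "t' \<in> trees k (Suc n) \<Longrightarrow> \<exists>t K p. t' = t @ [(K, p)]" for t'
    by (cases t' rule: rev_cases) (auto simp: trees_def valid_tree_def)
  then show ?thesis
    by (force simp: trees_def valid_tree_snoc image_iff)
qed

text \<open>Exchanging one vertex of a clique for the new node preserves its size. The bound on the
  vertices guarantees that \<open>Node (Suc n)\<close> is fresh, both here and in all later
  counts.\<close>

lemma
  assumes "t \<in> trees k n"
  shows finite_avail: "finite (avail k t (Suc n))"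
    and avail_clique: "K \<in> avail k t (Suc n) \<Longrightarrow> finite K \<and> card K = k \<and> K \<subseteq> range Root \<union> Node ` {1..n}"
proof -
  have "finite (avail k t (Suc n)) \<and> (\<forall>K\<in>avail k t (Suc n).
      finite K \<and> card K = k \<and> K \<subseteq> range Root \<union> Node ` {1..n})"
    using assms
  proof (induction n arbitrary: t)
    case 0
    then show ?case
      by (auto simp: trees_0 avail_def root_clique_def card_image inj_on_def)
  next
    case (Suc n)
    obtain t0 K p where t: "t = t0 @ [(K, p)]" and t0: "t0 \<in> trees k n"
      and K: "K \<in> avail k t0 (Suc n)"
      using Suc.prems unfolding trees_Suc by auto
    have len: "length t0 = n"
      using t0 by (auto simp: trees_def valid_tree_def)
    note IH = Suc.IH[OF t0]
    have Kp: "finite K" "card K = k" "K \<subseteq> range Root \<union> Node ` {1..n}"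
      using IH K by auto
    have nK: "Node (Suc n) \<notin> K"
      using Kp(3) by auto
    have av: "avail k t (Suc (Suc n)) =
        avail k t0 (Suc n) \<union> (\<lambda>w. insert (Node (Suc n)) (K - {w})) ` K"
      using avail_snoc[of k t0 K p] len t by simp
    have "card (insert (Node (Suc n)) (K - {w})) = k" if "w \<in> K" for w
      using that Kp nK by (metis DiffD1 card.remove card_insert_disjoint finite_Diff)
    moreover have mono: "L \<subseteq> range Root \<union> Node ` {1..Suc n}"
      if "L \<in> avail k t0 (Suc n)" for L
    proof -
      have "L \<subseteq> range Root \<union> Node ` {1..n}"
        using IH that by blast
      also have "\<dots> \<subseteq> range Root \<union> Node ` {1..Suc n}"
        by (intro Un_mono order_refl image_mono) auto
      finally show ?thesis .
    qed
    moreover have "insert (Node (Suc n)) (K - {w}) \<subseteq> range Root \<union> Node ` {1..Suc n}" for w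
    proof -
      have "Node (Suc n) \<in> Node ` {1..Suc n}"
        by (rule imageI) simp
      then show ?thesis
        using mono[OF K] by blast
    qed
    ultimately show ?case
      unfolding av using IH Kp(1) by blast
  qed
  then show "finite (avail k t (Suc n))"
    "K \<in> avail k t (Suc n) \<Longrightarrow> finite K \<and> card K = k \<and> K \<subseteq> range Root \<union> Node ` {1..n}"
    by blast+
qed

lemma length_trees: "t \<in> trees k n \<Longrightarrow> length t = n"
  by (auto simp: trees_def valid_tree_def)

lemma finite_trees: "finite (trees k n)"
  by (induction n) (auto simp: trees_0 trees_Suc finite_avail)

text \<open>Number of ways to insert the next node into a clique satisfying \<open>P\<close>: a clique with
  \<open>d\<close> children offers \<open>d + 1\<close> positions.\<close>

definition insertions :: "nat \<Rightarrow> ktree \<Rightarrow> (vtx set \<Rightarrow> bool) \<Rightarrow> nat" where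
  "insertions k t P = (\<Sum>K | K \<in> avail k t (Suc (length t)) \<and> P K. nchildren t (Suc (length t)) K + 1)"

lemma nchildren_new:
  assumes "t \<in> trees k n" "L \<notin> avail k t (Suc n)"
  shows "nchildren t (Suc n) L = 0"
proof -
  have "fst (t ! (x - 1)) \<noteq> L" if x: "x \<in> {1..<Suc n}" for x
  proof -
    have "fst (t ! (x - 1)) \<in> avail k t x"
      using assms(1) x by (auto simp: trees_def valid_tree_def)
    also have "avail k t x \<subseteq> avail k t (Suc n)"
      using x unfolding avail_def by force
    finally show ?thesis
      using assms(2) by auto
  qed
  then show ?thesis
    unfolding nchildren_def by (auto simp: card_eq_0_iff)
qed

text \<open>Attaching to \<open>K\<close> opens one more position at \<open>K\<close> itself, and
  each new clique \<open>insert (Node (Suc n)) (K - {w})\<close> starts childless, hence with a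
  single position.\<close>

lemma insertions_snoc:
  assumes t: "t \<in> trees k n" and K: "K \<in> avail k t (Suc n)"
  shows "insertions k (t @ [(K, p)]) P = insertions k t P + (if P K then 1 else 0) +
     card {w \<in> K. P (insert (Node (Suc n)) (K - {w}))}"
proof -
  have len: "length t = n"
    using t by (rule length_trees)
  let ?new = "\<lambda>w. insert (Node (Suc n)) (K - {w})"
  let ?A = "{L \<in> avail k t (Suc n). P L}"
  let ?B = "?new ` {w \<in> K. P (?new w)}"
  have Kp: "finite K" "K \<subseteq> range Root \<union> Node ` {1..n}"
    using avail_clique[OF t K] by auto
  have fin: "finite ?A"
    using finite_avail[OF t] by simp
  have new: "?new w \<notin> avail k t (Suc n)" for w
  proof
    assume "?new w \<in> avail k t (Suc n)"
    then have "Node (Suc n) \<in> range Root \<union> Node ` {1..n}"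
      using avail_clique[OF t] by blast
    then show False
      by auto
  qed
  \<comment> \<open>The deleted vertex \<open>w\<close> is recovered from the new clique as the only
    vertex of \<open>K\<close> missing in it.\<close>
  have inj: "inj_on ?new K"
  proof (rule inj_onI)
    fix v w
    assume *: "v \<in> K" "w \<in> K" "?new v = ?new w"
    have "Node (Suc n) \<notin> K"
      using Kp(2) by auto
    then have "v \<notin> ?new v"
      using *(1) by (metis Diff_iff insertE insertI1)
    moreover have "v \<in> ?new w" if "v \<noteq> w"
      using *(1) that by simp
    ultimately show "v = w"
      using *(3) by metis
  qed
  have "{L \<in> avail k (t @ [(K, p)]) (Suc (Suc n)). P L} = ?A \<union> ?B"
    using avail_snoc[of k t K p] len by auto
  then have "insertions k (t @ [(K, p)]) P =
      (\<Sum>L\<in>?A \<union> ?B. nchildren t (Suc n) L + (if L = K then 1 else 0) + 1)"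
    unfolding insertions_def using nchildren_snoc[of t K p] len by simp
  also have "\<dots> = (\<Sum>L\<in>?A. nchildren t (Suc n) L + (if L = K then 1 else 0) + 1) +
      (\<Sum>L\<in>?B. nchildren t (Suc n) L + (if L = K then 1 else 0) + 1)"
    using fin new Kp by (intro sum.union_disjoint) auto
  also have "(\<Sum>L\<in>?A. nchildren t (Suc n) L + (if L = K then 1 else 0) + 1) =
      (\<Sum>L\<in>?A. nchildren t (Suc n) L + 1) + (\<Sum>L\<in>?A. if L = K then 1 else 0)"
    by (simp add: sum.distrib[symmetric] algebra_simps)
  also have "(\<Sum>L\<in>?A. if L = K then 1 else 0) = (if P K then 1 else (0::nat))"
    using fin K by (simp add: sum.delta)
  also have "(\<Sum>L\<in>?A. nchildren t (Suc n) L + 1) = insertions k t P"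
    unfolding insertions_def len ..
  also have "(\<Sum>L\<in>?B. nchildren t (Suc n) L + (if L = K then 1 else 0) + 1) = (\<Sum>L\<in>?B. 1)"
  proof (rule sum.cong[OF refl])
    fix L assume "L \<in> ?B"
    then have "L \<notin> avail k t (Suc n)"
      using new by blast
    then show "nchildren t (Suc n) L + (if L = K then 1 else 0) + 1 = 1"
      using K nchildren_new[OF t] by auto
  qed
  also have "\<dots> = card {w \<in> K. P (?new w)}"
    using inj by (simp add: card_image inj_on_def)
  finally show ?thesis
    by simp
qed

lemma insertions_True:
  assumes "t \<in> trees k n"
  shows "insertions k t (\<lambda>_. True) = 1 + (k + 1) * n"
  using assms
proof (induction n arbitrary: t)
  case 0
  then show ?case
    by (simp add: trees_0 insertions_def avail_def nchildren_def)
next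
  case (Suc n)
  obtain t0 K p where t: "t = t0 @ [(K, p)]" and t0: "t0 \<in> trees k n"
    and K: "K \<in> avail k t0 (Suc n)"
    using Suc.prems unfolding trees_Suc by auto
  show ?case
    unfolding t insertions_snoc[OF t0 K] Suc.IH[OF t0]
    using avail_clique[OF t0 K] by simp
qed

text \<open>If the new node joins a clique containing \<open>Node j\<close>, that clique gains a
  position and the \<open>k - 1\<close> new cliques that keep \<open>Node j\<close> bring one each,
  so the count grows by \<open>k\<close>; a later node joining any other clique changes nothing. At
  its own insertion \<open>Node j\<close> lies in exactly the \<open>k\<close> new cliques; the
  second conjunct supplies the out-degree 0 needed there.\<close>

lemma insertions_Node:
  assumes "t \<in> trees k n" "1 \<le> j"
  shows "insertions k t (\<lambda>K. Node j \<in> K) = (if j \<le> n then k * (outdeg t (Node j) + 1) else 0)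
    \<and> (n < j \<longrightarrow> outdeg t (Node j) = 0)"
  using assms
proof (induction n arbitrary: t)
  case 0
  then have none: "{K. K \<in> avail k t (Suc (length t)) \<and> Node j \<in> K} = {}"
    by (auto simp: trees_0 avail_def root_clique_def)
  show ?case
    unfolding insertions_def none using 0 by (simp add: trees_0 outdeg_def)
next
  case (Suc n)
  obtain t0 K p where t: "t = t0 @ [(K, p)]" and t0: "t0 \<in> trees k n"
    and K: "K \<in> avail k t0 (Suc n)"
    using Suc.prems unfolding trees_Suc by auto
  have Kp: "finite K" "card K = k" "K \<subseteq> range Root \<union> Node ` {1..n}"
    using avail_clique[OF t0 K] by auto
  consider "j \<le> n" | "j = Suc n" | "Suc n < j"
    by linarith
  then show ?case
  proof cases
    case 1
    show ?thesis
    proof (cases "Node j \<in> K")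
      case True
      have "{w \<in> K. Node j \<in> insert (Node (Suc n)) (K - {w})} = K - {Node j}"
        using 1 True by auto
      \<comment> \<open>Needed for \<open>k - 1 + 1 = k\<close>, since the subtraction coming from
        \<open>card (K - {Node j})\<close> is truncated.\<close>
      moreover have "1 \<le> k"
        using True Kp by (metis One_nat_def Suc_leI card_gt_0_iff empty_iff)
      ultimately show ?thesis
        unfolding t insertions_snoc[OF t0 K] outdeg_snoc using Suc.IH[OF t0 Suc.prems(2)] 1 True Kp
        by simp
    next
      case False
      have "{w \<in> K. Node j \<in> insert (Node (Suc n)) (K - {w})} = {}"
        using 1 False by auto
      then show ?thesis
        unfolding t insertions_snoc[OF t0 K] outdeg_snoc using Suc.IH[OF t0 Suc.prems(2)] 1 False
        by simp
    qed
  next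
    case 2
    then have "Node j \<notin> K"
      using Kp by auto
    then show ?thesis
      unfolding t insertions_snoc[OF t0 K] outdeg_snoc
      using Suc.IH[OF t0 Suc.prems(2)] 2 Kp by simp
  next
    case 3
    then have "Node j \<notin> K"
      using Kp by auto
    then show ?thesis
      unfolding t insertions_snoc[OF t0 K] outdeg_snoc
      using Suc.IH[OF t0 Suc.prems(2)] 3 by simp
  qed
qed

text \<open>The out-degree is a Markov chain: a node of out-degree \<open>d\<close> gains a child in
  \<open>k (d + 1)\<close> of the \<open>1 + (k + 1) n\<close> possible insertions.\<close>

lemma sum_trees_Suc:
  fixes f :: "nat \<Rightarrow> real"
  assumes j: "1 \<le> j" "j \<le> n"
  shows "(\<Sum>t\<in>trees k (Suc n). f (outdeg t (Node j))) =
    (\<Sum>t\<in>trees k n. (real (1 + (k + 1) * n) - real (k * (outdeg t (Node j) + 1))) * f (outdeg t (Node j))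
       + real (k * (outdeg t (Node j) + 1)) * f (outdeg t (Node j) + 1))"
proof -
  let ?o = "\<lambda>t. outdeg t (Node j)"
  let ?A = "\<lambda>t. avail k t (Suc n)"
  have "inj_on (\<lambda>(t, K, p). t @ [(K, p)])
      (SIGMA t:trees k n. SIGMA K:avail k t (Suc n). {..nchildren t (Suc n) K})"
    by (auto simp: inj_on_def)
  then have "(\<Sum>t\<in>trees k (Suc n). f (?o t)) =
      (\<Sum>(t, K, p)\<in>(SIGMA t:trees k n. SIGMA K:?A t. {..nchildren t (Suc n) K}).
          f (?o (t @ [(K, p)])))"
    unfolding trees_Suc by (subst sum.reindex) (auto simp: o_def case_prod_unfold)
  also have "\<dots> = (\<Sum>t\<in>trees k n. \<Sum>(K, p)\<in>(SIGMA K:?A t. {..nchildren t (Suc n) K}).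
          f (?o (t @ [(K, p)])))"
    by (subst sum.Sigma) (auto simp: finite_trees finite_avail)
  also have "\<dots> = (\<Sum>t\<in>trees k n. \<Sum>K\<in>?A t. \<Sum>p\<le>nchildren t (Suc n) K. f (?o (t @ [(K, p)])))"
    by (intro sum.cong refl, subst sum.Sigma) (auto simp: finite_avail)
  also have "\<dots> = (\<Sum>t\<in>trees k n. (real (1 + (k + 1) * n) - real (k * (?o t + 1))) * f (?o t)
       + real (k * (?o t + 1)) * f (?o t + 1))"
  proof (rule sum.cong[OF refl])
    fix t assume t: "t \<in> trees k n"
    let ?w = "\<lambda>K. real (nchildren t (Suc n) K + 1)"
    have fin: "finite (?A t)"
      using t by (rule finite_avail)
    have total: "(\<Sum>K\<in>?A t. ?w K) = real (1 + (k + 1) * n)"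
      using arg_cong[OF insertions_True[OF t], of real]
      unfolding insertions_def length_trees[OF t] of_nat_sum by simp
    have Node: "(\<Sum>K\<in>?A t. if Node j \<in> K then ?w K else 0) = real (k * (?o t + 1))"
    proof -
      have "insertions k t (\<lambda>K. Node j \<in> K) = k * (?o t + 1)"
        using insertions_Node[OF t j(1)] j(2) by simp
      then have "(\<Sum>K | K \<in> ?A t \<and> Node j \<in> K. ?w K) = real (k * (?o t + 1))"
        unfolding insertions_def length_trees[OF t] by (metis of_nat_sum)
      then show ?thesis
        using sum.inter_filter[OF fin] by metis
    qed
    \<comment> \<open>The new out-degree depends on the clique but not on the position, so the inner
      sum just contributes the weight of the clique.\<close>
    have "(\<Sum>K\<in>?A t. \<Sum>p\<le>nchildren t (Suc n) K. f (?o (t @ [(K, p)]))) =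
        (\<Sum>K\<in>?A t. ?w K * f (?o t) +
           (if Node j \<in> K then ?w K else 0) * (f (?o t + 1) - f (?o t)))"
      by (intro sum.cong refl) (auto simp: outdeg_snoc algebra_simps)
    also have "\<dots> = (\<Sum>K\<in>?A t. ?w K) * f (?o t) +
        (\<Sum>K\<in>?A t. if Node j \<in> K then ?w K else 0) * (f (?o t + 1) - f (?o t))"
      unfolding sum.distrib sum_distrib_right ..
    also have "\<dots> = (real (1 + (k + 1) * n) - real (k * (?o t + 1))) * f (?o t)
       + real (k * (?o t + 1)) * f (?o t + 1)"
      unfolding total Node by (simp add: algebra_simps)
    finally show "(\<Sum>K\<in>?A t. \<Sum>p\<le>nchildren t (Suc n) K. f (?o (t @ [(K, p)]))) =
        (real (1 + (k + 1) * n) - real (k * (?o t + 1))) * f (?o t)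
       + real (k * (?o t + 1)) * f (?o t + 1)" .
  qed
  finally show ?thesis .
qed

lemma card_trees_Suc: "card (trees k (Suc n)) = (1 + (k + 1) * n) * card (trees k n)"
proof -
  have "inj_on (\<lambda>(t, K, p). t @ [(K, p)])
      (SIGMA t:trees k n. SIGMA K:avail k t (Suc n). {..nchildren t (Suc n) K})"
    by (auto simp: inj_on_def)
  then have "card (trees k (Suc n)) =
      card (SIGMA t:trees k n. SIGMA K:avail k t (Suc n). {..nchildren t (Suc n) K})"
    unfolding trees_Suc by (rule card_image)
  also have "\<dots> = (\<Sum>t\<in>trees k n. \<Sum>K\<in>avail k t (Suc n). nchildren t (Suc n) K + 1)"
    by (simp add: finite_trees finite_avail)
  also have "\<dots> = (\<Sum>t\<in>trees k n. 1 + (k + 1) * n)"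
    using insertions_True by (intro sum.cong refl) (auto simp: insertions_def length_trees)
  finally show ?thesis
    by simp
qed

section \<open>Expectations under the uniform distribution\<close>

lemma card_trees_pos: "card (trees k n) > 0"
  by (induction n) (auto simp: trees_0 card_trees_Suc)

lemma trees_nonempty: "trees k n \<noteq> {}"
  using card_trees_pos[of k n] by auto

lemma expectation_Y:
  fixes f :: "nat \<Rightarrow> real"
  shows "measure_pmf.expectation (Y k n j) f =
    (\<Sum>t\<in>trees k n. f (outdeg t (Node j))) / card (trees k n)"
  unfolding Y_def by (simp add: integral_pmf_of_set finite_trees trees_nonempty)

text \<open>The total number of insertions is
  \<open>1 + (k + 1) * n = (k + 1) * (Suc n - c)\<close>, which turns the weight
  \<open>k * (m + 1)\<close> into the jump probability
  \<open>c * (m + 1) / (Suc n - c)\<close>.\<close>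

lemma expectation_Y_Suc:
  fixes f :: "nat \<Rightarrow> real"
  assumes j: "1 \<le> j" "j \<le> n" and c: "c = real k / real (k + 1)"
  shows "measure_pmf.expectation (Y k (Suc n) j) f = measure_pmf.expectation (Y k n j)
     (\<lambda>m. f m + c * (real m + 1) / (real (Suc n) - c) * (f (m + 1) - f m))"
proof -
  let ?T = "real (1 + (k + 1) * n)"
  have T: "?T = real (k + 1) * (real (Suc n) - c)"
    unfolding c by (simp add: field_simps)
  have pos: "?T > 0"
    unfolding of_nat_0_less_iff by simp
  have q: "c * (real m + 1) / (real (Suc n) - c) = real (k * (m + 1)) / ?T" for m
    unfolding T unfolding c by (simp add: field_simps)
  have "measure_pmf.expectation (Y k (Suc n) j) f =
      (\<Sum>t\<in>trees k n. ((?T - real (k * (outdeg t (Node j) + 1))) * f (outdeg t (Node j))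
       + real (k * (outdeg t (Node j) + 1)) * f (outdeg t (Node j) + 1)) / ?T) / card (trees k n)"
    unfolding expectation_Y sum_trees_Suc[OF j] card_trees_Suc of_nat_mult[of "1 + (k + 1) * n"]
    by (simp only: sum_divide_distrib divide_divide_eq_left)
  also have "\<dots> = measure_pmf.expectation (Y k n j)
     (\<lambda>m. f m + c * (real m + 1) / (real (Suc n) - c) * (f (m + 1) - f m))"
    unfolding expectation_Y q
    using pos by (intro arg_cong2[where f="(/)"] sum.cong refl) (simp add: field_simps)
  finally show ?thesis .
qed

lemma expectation_Y_base:
  fixes f :: "nat \<Rightarrow> real"
  assumes "1 \<le> j"
  shows "measure_pmf.expectation (Y k j j) f = f 0"
proof -
  have "outdeg t (Node j) = 0" if t: "t \<in> trees k j" for t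
  proof -
    obtain n where n: "j = Suc n"
      using assms by (cases j) auto
    obtain t0 K p where t0: "t = t0 @ [(K, p)]" "t0 \<in> trees k n" "K \<in> avail k t0 (Suc n)"
      using t unfolding trees_Suc n by auto
    have "Node (Suc n) \<notin> K"
      using avail_clique[OF t0(2,3)] by auto
    moreover have "outdeg t0 (Node j) = 0"
      using insertions_Node[OF t0(2) assms] n by simp
    ultimately show ?thesis
      using n by (simp add: t0 outdeg_snoc)
  qed
  then show ?thesis
    unfolding expectation_Y using card_trees_pos[of k j] by simp
qed

lemma finite_set_pmf_Y: "finite (set_pmf (Y k n j))"
  unfolding Y_def by (simp add: finite_trees trees_nonempty)

section \<open>Probabilities and rising factorial moments\<close>

text \<open>Solution of a one-step multiplicative recurrence run from time \<open>j\<close> to time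
  \<open>n\<close>. It is used with \<open>b = - c\<close>, taking \<open>a = - c * (2 + l)\<close>
  for probabilities and \<open>a = c * (s - 1)\<close> for rising factorial moments.\<close>

definition shift_prod :: "real \<Rightarrow> real \<Rightarrow> nat \<Rightarrow> nat \<Rightarrow> real" where
  "shift_prod a b j n = (\<Prod>i\<in>{j<..n}. (real i + a) / (real i + b))"

lemma shift_prod_refl [simp]: "shift_prod a b j j = 1"
  by (simp add: shift_prod_def)

lemma shift_prod_Suc:
  "j \<le> n \<Longrightarrow> shift_prod a b j (Suc n) = shift_prod a b j n * ((real (Suc n) + a) / (real (Suc n) + b))"
proof -
  assume "j \<le> n"
  then have "{j<..Suc n} = insert (Suc n) {j<..n}"
    by auto
  then show ?thesis
    by (simp add: shift_prod_def mult.commute)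
qed

lemma integrable_Y: "integrable (measure_pmf (Y k n j)) (f :: nat \<Rightarrow> real)"
  by (rule integrable_measure_pmf_finite) (rule finite_set_pmf_Y)

lemma pmf_eq_expectation: "pmf p m = measure_pmf.expectation p (\<lambda>x. if x = m then 1 else 0 :: real)"
proof -
  have "(\<lambda>x. if x = m then 1 else 0 :: real) = indicator {m}"
    by (auto simp: indicator_def)
  then show ?thesis
    by (simp add: measure_pmf_single)
qed

text \<open>Forward equation of the chain, obtained from the indicator of \<open>m\<close> as test
  function: either the chain stays at \<open>m\<close> or it arrives from \<open>m - 1\<close>. For
  \<open>m = 0\<close> the truncated \<open>m - 1\<close> is harmless because its coefficient is
  0.\<close>

lemma pmf_Y_Suc:
  assumes j: "1 \<le> j" "j \<le> n" and c: "c = real k / real (k + 1)"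
  defines "D \<equiv> real (Suc n) - c"
  shows "pmf (Y k (Suc n) j) m =
    (1 - c * (real m + 1) / D) * pmf (Y k n j) m + c * real m / D * pmf (Y k n j) (m - 1)"
proof -
  let ?f = "\<lambda>m x. if x = m then 1 else 0 :: real"
  have "?f m x + c * (real x + 1) / D * (?f m (x + 1) - ?f m x) =
      (1 - c * (real m + 1) / D) * ?f m x + c * real m / D * ?f (m - 1) x" for x
    by (cases m) auto
  then show ?thesis
    unfolding pmf_eq_expectation expectation_Y_Suc[OF j c] D_def[symmetric]
    by (simp only:) (simp only: Bochner_Integration.integral_add integral_mult_right_zero integrable_Y)
qed

text \<open>At each step the \<open>l\<close>-th product gains the factor
  \<open>1 - c * (l + 1) / D\<close>. Writing \<open>l + 1 = (m + 1) - (m - l)\<close>, the first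
  part reproduces the staying term, and the absorption identity for
  \<open>(m - l) * (m choose l)\<close> turns the second into the term for
  \<open>m - 1\<close>.\<close>

lemma pmf_Y_shift_prod:
  assumes j: "1 \<le> j" "j \<le> n" and c: "c = real k / real (k + 1)"
  shows "pmf (Y k n j) m =
    (\<Sum>l\<le>m. real (m choose l) * (-1) ^ l * shift_prod (- (c * (2 + real l))) (- c) j n)"
  using j(2)
proof (induction n arbitrary: m rule: dec_induct)
  case base
  \<comment> \<open>The expansion of \<open>(1 - 1) ^ m\<close> is the point mass at 0 in which the
    chain starts.\<close>
  have "(\<Sum>l\<le>m. real (m choose l) * (-1) ^ l) = (if m = 0 then 1 else 0 :: real)"
  proof -
    have "(\<Sum>l\<le>m. real (m choose l) * (-1) ^ l) = (1 + (-1)) ^ m"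
      using binomial_ring[of "- 1 :: real" 1 m] by (simp add: add.commute)
    then show ?thesis
      by (simp add: zero_power)
  qed
  then show ?case
    unfolding pmf_eq_expectation expectation_Y_base[OF j(1)] by simp
next
  case (step n)
  define D where "D = real (Suc n) - c"
  define R where "R l = shift_prod (- (c * (2 + real l))) (- c) j n" for l
  have "c < 1"
    unfolding c by simp
  then have D: "D > 0"
    unfolding D_def by simp
  have Suc: "shift_prod (- (c * (2 + real l))) (- c) j (Suc n) =
      (1 - c * (real m + 1) / D) * R l + c / D * ((real m - real l) * R l)" for l
  proof -
    have "(real (Suc n) + - (c * (2 + real l))) / (real (Suc n) + - c) =
        1 - c * (real m + 1) / D + c / D * (real m - real l)"
    proof -
      have num: "real (Suc n) + - (c * (2 + real l)) = D - c * (real m + 1) + c * (real m - real l)"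
        unfolding D_def by (simp add: algebra_simps)
      have den: "real (Suc n) + - c = D"
        unfolding D_def by simp
      show ?thesis
        unfolding num den using D by (simp add: add_divide_distrib diff_divide_distrib)
    qed
    then show ?thesis
      using shift_prod_Suc[OF step.hyps(1), of "- (c * (2 + real l))" "- c"] unfolding R_def
      by (simp only:) (simp add: algebra_simps)
  qed
  have shift: "(\<Sum>l\<le>m. real (m choose l) * (-1) ^ l * ((real m - real l) * R l)) =
      real m * (\<Sum>l\<le>m - 1. real ((m - 1) choose l) * (-1) ^ l * R l)"
  proof (cases m)
    case (Suc m')
    have absorb: "real (m choose l) * (real m - real l) = real m * real (m' choose l)" if "l \<le> m'" for l
    proof -
      have "real (m - l) * real (m choose l) = real m * real (m' choose l)"
        unfolding of_nat_mult[symmetric] binomial_absorb_comp Suc by simp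
      moreover have "real (m - l) = real m - real l"
        using that Suc by (intro of_nat_diff) simp
      ultimately show ?thesis
        by (simp only: mult.commute)
    qed
    have "(\<Sum>l\<le>m. real (m choose l) * (-1) ^ l * ((real m - real l) * R l)) =
        (\<Sum>l\<le>m'. real (m choose l) * (-1) ^ l * ((real m - real l) * R l))"
      unfolding Suc sum.atMost_Suc by simp
    also have "\<dots> = (\<Sum>l\<le>m'. real m * (real (m' choose l) * (-1) ^ l * R l))"
    proof (rule sum.cong[OF refl])
      fix l assume "l \<in> {..m'}"
      then have "(real (m choose l) * (real m - real l)) * ((-1) ^ l * R l) =
          (real m * real (m' choose l)) * ((-1) ^ l * R l)"
        using absorb by simp
      then show "real (m choose l) * (-1) ^ l * ((real m - real l) * R l) =
          real m * (real (m' choose l) * (-1) ^ l * R l)"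
        by (simp only: mult_ac)
    qed
    finally show ?thesis
      using Suc by (simp add: sum_distrib_left)
  qed simp
  have "(\<Sum>l\<le>m. real (m choose l) * (-1) ^ l * shift_prod (- (c * (2 + real l))) (- c) j (Suc n)) =
      (\<Sum>l\<le>m. (1 - c * (real m + 1) / D) * (real (m choose l) * (-1) ^ l * R l) +
        c / D * (real (m choose l) * (-1) ^ l * ((real m - real l) * R l)))"
    unfolding Suc by (intro sum.cong refl) (simp add: algebra_simps)
  also have "\<dots> = (1 - c * (real m + 1) / D) * pmf (Y k n j) m +
      c / D * (real m * pmf (Y k n j) (m - 1))"
    unfolding sum.distrib sum_distrib_left[symmetric] shift step.IH R_def[symmetric] ..
  also have "\<dots> = pmf (Y k (Suc n) j) m"
    using pmf_Y_Suc[OF j(1) step.hyps(1) c, of m] unfolding D_def by simp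
  finally show ?case ..
qed

lemma prod_greaterThanAtMost_gchoose:
  assumes "j \<le> n"
  shows "(\<Prod>i\<in>{j<..n}. real i - b) = fact (n - j) * ((real n - b) gchoose (n - j))"
proof -
  have "(\<Prod>i\<in>{j<..n}. real i - b) = (\<Prod>i<n - j. real n - b - real i)"
    using assms by (intro prod.reindex_bij_witness[of _ "\<lambda>i. n - i" "\<lambda>i. n - i"]) (auto simp: of_nat_diff)
  then show ?thesis
    by (simp add: gbinomial_prod_rev atLeast0LessThan)
qed

text \<open>The denominator is a quotient of the full products up to \<open>n\<close> and up to
  \<open>j\<close>; the remaining factorials combine to \<open>n choose j\<close>. Since
  \<open>c < 1\<close>, no factor \<open>i - c\<close> vanishes.\<close>

lemma shift_prod_gchoose:
  assumes j: "j \<le> n" and c: "c < 1"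
  shows "shift_prod (- a) (- c) j n =
    ((real j - c) gchoose j) / (((real n - c) gchoose n) * real (n choose j)) * ((real n - a) gchoose (n - j))"
proof -
  have split: "(\<Prod>i\<in>{0<..n}. real i - c) = (\<Prod>i\<in>{0<..j}. real i - c) * (\<Prod>i\<in>{j<..n}. real i - c)"
    using j by (subst prod.union_disjoint[symmetric]) (auto intro!: prod.cong)
  have nz: "(\<Prod>i\<in>{0<..j}. real i - c) \<noteq> 0" "(\<Prod>i\<in>{j<..n}. real i - c) \<noteq> 0"
    using c by (auto simp: prod_zero_iff)
  have "shift_prod (- a) (- c) j n = (\<Prod>i\<in>{j<..n}. real i - a) / (\<Prod>i\<in>{j<..n}. real i - c)"
    unfolding shift_prod_def by (simp add: prod_dividef)
  also have "\<dots> = (\<Prod>i\<in>{j<..n}. real i - a) * (\<Prod>i\<in>{0<..j}. real i - c) / (\<Prod>i\<in>{0<..n}. real i - c)"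
    unfolding split using nz by simp
  also have "\<dots> = ((real j - c) gchoose j) / (((real n - c) gchoose n) * real (n choose j)) * ((real n - a) gchoose (n - j))"
    using j by (simp add: prod_greaterThanAtMost_gchoose binomial_fact mult_ac)
  finally show ?thesis .
qed

text \<open>Rising factorials of \<open>Y + 1\<close> are eigenfunctions of the transition operator,
  which is why they, rather than the powers of \<open>Y\<close>, have product-form expectations.\<close>

lemma expectation_Y_pochhammer:
  assumes j: "1 \<le> j" "j \<le> n" and c: "c = real k / real (k + 1)"
  shows "measure_pmf.expectation (Y k n j) (\<lambda>m. pochhammer (real m + 1) s) =
    fact s * shift_prod (c * (real s - 1)) (- c) j n"
  using j(2)
proof (induction n rule: dec_induct)
  case base
  show ?case
    unfolding expectation_Y_base[OF j(1)] by (simp add: pochhammer_fact)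
next
  case (step n)
  define D where "D = real (Suc n) - c"
  have "c < 1"
    unfolding c by simp
  then have D: "D > 0"
    unfolding D_def by simp
  \<comment> \<open>With \<open>x = m + 1\<close>, splitting off the first or the last factor of the
    rising factorial of length \<open>s + 1\<close> gives
    \<open>x * pochhammer (x + 1) s = (x + s) * pochhammer x s\<close>.\<close>
  have diff: "(real m + 1) * (pochhammer (real (m + 1) + 1) s - pochhammer (real m + 1) s) =
      real s * pochhammer (real m + 1) s" for m
    using pochhammer_rec[of "real m + 1" s] pochhammer_rec'[of "real m + 1" s]
    by (simp add: algebra_simps)
  have "pochhammer (real m + 1) s + c * (real m + 1) / D *
      (pochhammer (real (m + 1) + 1) s - pochhammer (real m + 1) s) =
      (1 + c * real s / D) * pochhammer (real m + 1) s" for m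
  proof -
    have "c * (real m + 1) / D * (pochhammer (real (m + 1) + 1) s - pochhammer (real m + 1) s) =
        c / D * ((real m + 1) * (pochhammer (real (m + 1) + 1) s - pochhammer (real m + 1) s))"
      by simp
    then show ?thesis
      unfolding diff by (simp add: algebra_simps)
  qed
  then have "measure_pmf.expectation (Y k (Suc n) j) (\<lambda>m. pochhammer (real m + 1) s) =
      (1 + c * real s / D) * (fact s * shift_prod (c * (real s - 1)) (- c) j n)"
    unfolding expectation_Y_Suc[OF j(1) step.hyps(1) c] D_def[symmetric] by (simp add: step.IH)
  moreover have "1 + c * real s / D = (real (Suc n) + c * (real s - 1)) / (real (Suc n) + - c)"
    using D by (simp add: D_def field_simps)
  ultimately show ?case
    using step.hyps by (simp add: shift_prod_Suc mult_ac)
qed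

section \<open>Gamma asymptotics of the products\<close>

lemma shift_prod_Gamma:
  assumes j: "j \<le> n" and a: "0 < real j + 1 + a" and b: "0 < real j + 1 + b"
  shows "shift_prod a b j n =
    Gamma (real n + 1 + a) * Gamma (real j + 1 + b) / (Gamma (real j + 1 + a) * Gamma (real n + 1 + b))"
  using j
proof (induction n rule: dec_induct)
  case base
  show ?case
    using Gamma_real_pos[OF a] Gamma_real_pos[OF b] by simp
next
  case (step n)
  have pos: "0 < real n + 1 + a" "0 < real n + 1 + b"
    using a b step.hyps by auto
  have "Gamma (real (Suc n) + 1 + d) = (real n + 1 + d) * Gamma (real n + 1 + d)"
    if "0 < real n + 1 + d" for d
    using Gamma_plus1[of "real n + 1 + d"] that by (simp add: nonpos_Ints_def add_ac)
  then show ?case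
    using step pos by (simp add: shift_prod_Suc add_ac mult_ac)
qed

text \<open>Compares \<open>Gamma (n + 1 + a)\<close> with its leading-order growth
  \<open>n! * n powr a\<close>.\<close>

definition Gamma_quot :: "real \<Rightarrow> nat \<Rightarrow> real" where
  "Gamma_quot a n = Gamma (real n + 1 + a) / (fact n * real n powr a)"

text \<open>For positive arguments this is Euler's limit formula for Gamma. The functional equation
  carries the limit from \<open>a + 1\<close> down to \<open>a\<close>, so finitely many steps reach
  every real \<open>a\<close>.\<close>

lemma Gamma_quot_LIMSEQ: "Gamma_quot a \<longlonglongrightarrow> 1"
proof -
  have pos: "Gamma_quot z \<longlonglongrightarrow> 1" if z: "0 < z" for z
  proof -
    have Gz: "Gamma z > 0"
      using z by (rule Gamma_real_pos)
    have "\<forall>\<^sub>F n in sequentially. Gamma z / Gamma_series z n = Gamma_quot z n"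
      using eventually_gt_at_top[of 0]
    proof eventually_elim
      case (elim n)
      have "z \<notin> \<int>\<^sub>\<le>\<^sub>0"
        using z by (auto simp: nonpos_Ints_def)
      then show ?case
        using elim Gz pochhammer_Gamma[of z "n + 1"]
        by (simp add: Gamma_series_def Gamma_quot_def powr_def add_ac mult_ac)
    qed
    moreover have "(\<lambda>n. Gamma z / Gamma_series z n) \<longlonglongrightarrow> Gamma z / Gamma z"
      using Gz by (intro tendsto_intros Gamma_series_LIMSEQ) auto
    ultimately show ?thesis
      using Gz by (simp add: tendsto_cong)
  qed
  have down: "Gamma_quot a \<longlonglongrightarrow> 1" if "Gamma_quot (a + 1) \<longlonglongrightarrow> 1" for a
  proof -
    have "\<forall>\<^sub>F n in sequentially. Gamma_quot (a + 1) n * (real n / (real n + 1 + a)) = Gamma_quot a n"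
      using eventually_gt_at_top[of "nat \<lceil>\<bar>a\<bar>\<rceil>"]
    proof eventually_elim
      case (elim n)
      then have n: "0 < real n" "0 < real n + 1 + a"
        by linarith+
      have "Gamma (real n + 1 + a + 1) = (real n + 1 + a) * Gamma (real n + 1 + a)"
        using n by (intro Gamma_plus1) (auto simp: nonpos_Ints_def)
      then show ?case
        using n by (simp add: Gamma_quot_def powr_add add_ac)
    qed
    moreover have "(\<lambda>n. Gamma_quot (a + 1) n * (real n / (real n + 1 + a))) \<longlonglongrightarrow> 1 * 1"
      by (intro tendsto_mult that) real_asymp
    ultimately show ?thesis
      by (simp add: tendsto_cong)
  qed
  have shift: "Gamma_quot (a + real N) \<longlonglongrightarrow> 1 \<Longrightarrow> Gamma_quot a \<longlonglongrightarrow> 1" for N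
  proof (induction N)
    case (Suc N)
    then have "Gamma_quot (a + real N + 1) \<longlonglongrightarrow> 1"
      by (simp add: add_ac)
    then show ?case
      by (rule Suc.IH[OF down])
  qed simp
  show ?thesis
    by (rule shift[of "nat \<lceil>1 - a\<rceil>"], rule pos) linarith
qed

lemma shift_prod_Gamma_quot:
  assumes "0 < j" "j \<le> n" and a: "0 < real j + 1 + a" and b: "0 < real j + 1 + b"
  shows "shift_prod a b j n = Gamma_quot a n * Gamma_quot b j / (Gamma_quot a j * Gamma_quot b n)
    * (real j / real n) powr (b - a)"
  using assms(1,2)
  by (simp add: shift_prod_Gamma[OF assms(2) a b] Gamma_quot_def powr_divide powr_diff)

text \<open>Both ends of the product tend to infinity, so all four Gamma quotients tend to 1 and
  only the power of \<open>jn n / n\<close> remains.\<close>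

lemma shift_prod_asymp:
  fixes jn :: "nat \<Rightarrow> nat"
  assumes jn: "filterlim jn at_top sequentially" "\<forall>\<^sub>F n in sequentially. jn n \<le> n"
  shows "(\<lambda>n. shift_prod a b (jn n) n * (real (jn n) / real n) powr (a - b)) \<longlonglongrightarrow> 1"
proof -
  have jq: "(\<lambda>n. Gamma_quot d (jn n)) \<longlonglongrightarrow> 1" for d
    using filterlim_compose[OF Gamma_quot_LIMSEQ jn(1)] .
  \<comment> \<open>Beyond this threshold all Gamma arguments are positive.\<close>
  have "\<forall>\<^sub>F n in sequentially. nat \<lceil>\<bar>a\<bar> + \<bar>b\<bar>\<rceil> < jn n"
    using jn(1) eventually_gt_at_top filterlim_iff by blast
  with jn(2) have "\<forall>\<^sub>F n in sequentially.
      Gamma_quot a n * Gamma_quot b (jn n) / (Gamma_quot a (jn n) * Gamma_quot b n) =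
      shift_prod a b (jn n) n * (real (jn n) / real n) powr (a - b)"
  proof eventually_elim
    case (elim n)
    then have "0 < jn n" "0 < real (jn n) + 1 + a" "0 < real (jn n) + 1 + b"
      by linarith+
    with elim show ?case
      by (simp add: shift_prod_Gamma_quot powr_diff)
  qed
  moreover have "(\<lambda>n. Gamma_quot a n * Gamma_quot b (jn n) / (Gamma_quot a (jn n) * Gamma_quot b n))
      \<longlonglongrightarrow> 1 * 1 / (1 * 1)"
    by (intro tendsto_intros jq Gamma_quot_LIMSEQ) auto
  ultimately show ?thesis
    by (simp add: tendsto_cong)
qed

text \<open>With \<open>j\<close> fixed only the factors at \<open>n\<close> are replaced by their
  asymptotics; the Gamma values at \<open>j\<close> survive in the limit.\<close>

lemma shift_prod_asymp_fixed:
  assumes a: "0 < real j + 1 + a" and b: "0 < real j + 1 + b"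
  shows "(\<lambda>n. shift_prod a b j n * real n powr (b - a)) \<longlonglongrightarrow>
    Gamma (real j + 1 + b) / Gamma (real j + 1 + a)"
proof -
  have "\<forall>\<^sub>F n in sequentially. Gamma_quot a n / Gamma_quot b n * (Gamma (real j + 1 + b) / Gamma (real j + 1 + a)) =
      shift_prod a b j n * real n powr (b - a)"
    using eventually_gt_at_top[of j]
  proof eventually_elim
    case (elim n)
    then show ?case
      using a b by (simp add: shift_prod_Gamma Gamma_quot_def powr_diff mult_ac)
  qed
  moreover have "(\<lambda>n. Gamma_quot a n / Gamma_quot b n * (Gamma (real j + 1 + b) / Gamma (real j + 1 + a)))
      \<longlonglongrightarrow> 1 / 1 * (Gamma (real j + 1 + b) / Gamma (real j + 1 + a))"
    by (intro tendsto_intros Gamma_quot_LIMSEQ) auto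
  ultimately show ?thesis
    by (simp add: tendsto_cong)
qed

section \<open>The method of moments\<close>

text \<open>Clipping changes something only where \<open>K < \<bar>x\<bar>\<close>, and there
  \<open>K \<le> \<bar>x\<bar> ^ s\<close> bounds the error by
  \<open>\<bar>x\<bar> ^ s \<le> x ^ (2 * s) / K\<close>. The even exponent makes this controllable
  by an ordinary moment.\<close>

lemma power_clip_error:
  fixes x K :: real
  assumes "1 \<le> K" "1 \<le> s"
  shows "\<bar>x ^ s - max (- K) (min K x) ^ s\<bar> \<le> x ^ (2 * s) / K"
proof (cases "\<bar>x\<bar> \<le> K")
  case True
  then have "max (- K) (min K x) = x"
    by auto
  then show ?thesis
    using assms by (simp add: power_mult)
next
  case False
  have *: "\<bar>x ^ s - max (- K) (min K x) ^ s\<bar> = \<bar>x\<bar> ^ s - K ^ s"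
  proof (cases "K < x")
    case True
    then show ?thesis
      using assms power_mono[of K x s] by simp
  next
    case F: False
    then have x: "x < - K"
      using False by auto
    then have "max (- K) (min K x) = - K"
      using assms by auto
    moreover have "\<bar>x ^ s - (- K) ^ s\<bar> = \<bar>\<bar>x\<bar> ^ s - K ^ s\<bar>"
      using x assms by (cases "even s") (auto simp: power_minus_odd abs_minus_commute)
    ultimately show ?thesis
      using x assms power_mono[of K "\<bar>x\<bar>" s] by simp
  qed
  have "K \<le> \<bar>x\<bar> ^ s"
    using False assms self_le_power[of "\<bar>x\<bar>" s] by linarith
  then have "K * \<bar>x\<bar> ^ s \<le> \<bar>x\<bar> ^ s * \<bar>x\<bar> ^ s"
    by (intro mult_right_mono) auto
  also have "\<dots> = x ^ (2 * s)"
    by (simp add: power_mult power2_eq_square flip: power_mult_distrib)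
  finally have "\<bar>x\<bar> ^ s \<le> x ^ (2 * s) / K"
    using assms by (simp add: field_simps)
  moreover have "0 \<le> K ^ s"
    using assms by simp
  ultimately show ?thesis
    unfolding * by linarith
qed

lemma abs_power_clip_le:
  fixes x K :: real
  assumes "0 \<le> K"
  shows "\<bar>max (- K) (min K x) ^ s\<bar> \<le> K ^ s" "\<bar>max (- K) (min K x) ^ s\<bar> \<le> \<bar>x\<bar> ^ s"
  using assms unfolding power_abs by (auto intro!: power_mono)

text \<open>Weak convergence handles bounded continuous functions, so powers are clipped at
  \<open>K\<close>. The clipping error is at most the moment of order \<open>2 * s\<close> divided
  by \<open>K\<close>; it survives the limit in \<open>n\<close> and vanishes as \<open>K\<close>
  grows.\<close>

lemma weak_conv_moments:
  fixes \<mu> :: "nat \<Rightarrow> real measure"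
  assumes \<mu>: "\<And>n. real_distribution (\<mu> n)" and M: "real_distribution M"
    and weak: "weak_conv_m \<mu> M"
    and int: "\<And>n s. integrable (\<mu> n) (\<lambda>x. x ^ s)"
    and lim: "\<And>s. (\<lambda>n. \<integral>x. x ^ s \<partial>\<mu> n) \<longlonglongrightarrow> m s"
  shows "integrable M (\<lambda>x. x ^ s)" "(\<integral>x. x ^ s \<partial>M) = m s"
proof -
  interpret M: real_distribution M by fact
  define f where "f s K x = max (- K) (min K x) ^ s" for s :: nat and K x :: real
  have f_int: "integrable N (f s K)" if "real_distribution N" "0 \<le> K" for s K N
  proof -
    interpret N: real_distribution N by fact
    show ?thesis
      unfolding f_def using abs_power_clip_le(1)[OF that(2), of _ s]
      by (intro N.integrable_const_bound[where B="K ^ s"]) auto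
  qed
  have f_weak: "(\<lambda>n. \<integral>x. f s K x \<partial>\<mu> n) \<longlonglongrightarrow> (\<integral>x. f s K x \<partial>M)" if "0 \<le> K" for s K
    using abs_power_clip_le(1)[OF that, of _ s]
    by (intro weak_conv_imp_integral_bdd_continuous_conv[OF \<mu> M weak, where B="K ^ s"])
       (auto simp: f_def intro!: continuous_intros)
  have bound: "\<bar>(\<integral>x. f s K x \<partial>M) - m s\<bar> \<le> m (2 * s) / K" if K: "1 \<le> K" and s: "1 \<le> s" for K s
  proof (rule LIMSEQ_le)
    show "(\<lambda>n. \<bar>(\<integral>x. f s K x \<partial>\<mu> n) - (\<integral>x. x ^ s \<partial>\<mu> n)\<bar>) \<longlonglongrightarrow> \<bar>(\<integral>x. f s K x \<partial>M) - m s\<bar>"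
      using K by (intro tendsto_intros f_weak lim) auto
    show "(\<lambda>n. (\<integral>x. x ^ (2 * s) \<partial>\<mu> n) / K) \<longlonglongrightarrow> m (2 * s) / K"
      using K by (intro tendsto_intros lim) auto
    have "\<bar>(\<integral>x. f s K x \<partial>\<mu> n) - (\<integral>x. x ^ s \<partial>\<mu> n)\<bar> \<le> (\<integral>x. x ^ (2 * s) \<partial>\<mu> n) / K" for n
    proof -
      have err: "\<bar>f s K x - x ^ s\<bar> \<le> x ^ (2 * s) / K" for x
        using power_clip_error[OF K s, of x] by (simp add: f_def abs_minus_commute)
      have fi: "integrable (\<mu> n) (f s K)"
        using K by (intro f_int \<mu>) auto
      have "\<bar>(\<integral>x. f s K x \<partial>\<mu> n) - (\<integral>x. x ^ s \<partial>\<mu> n)\<bar> = norm (\<integral>x. f s K x - x ^ s \<partial>\<mu> n)"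
        using fi int by simp
      also have "\<dots> \<le> (\<integral>x. x ^ (2 * s) / K \<partial>\<mu> n)"
        using err fi int
        by (intro Bochner_Integration.integral_norm_bound_integral Bochner_Integration.integrable_diff) auto
      finally show ?thesis
        by simp
    qed
    then show "\<exists>N. \<forall>n\<ge>N. \<bar>(\<integral>x. f s K x \<partial>\<mu> n) - (\<integral>x. x ^ s \<partial>\<mu> n)\<bar> \<le> (\<integral>x. x ^ (2 * s) \<partial>\<mu> n) / K"
      by blast
  qed
  have f_lim: "(\<lambda>N. \<integral>x. f s (real (Suc N)) x \<partial>M) \<longlonglongrightarrow> m s" if s: "1 \<le> s" for s
  proof (rule LIM_zero_cancel, rule Lim_null_comparison)
    show "\<forall>\<^sub>F N in sequentially. norm ((\<integral>x. f s (real (Suc N)) x \<partial>M) - m s) \<le> m (2 * s) / real (Suc N)"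
      using bound[OF _ s] by simp
    show "(\<lambda>N. m (2 * s) / real (Suc N)) \<longlonglongrightarrow> 0"
      by real_asymp
  qed
  have f_pt: "(\<lambda>N. f s (real (Suc N)) x) \<longlonglongrightarrow> x ^ s" for s x
  proof (rule tendsto_eventually)
    have "\<forall>\<^sub>F N in sequentially. nat \<lceil>\<bar>x\<bar>\<rceil> \<le> N"
      by (rule eventually_ge_at_top)
    then show "\<forall>\<^sub>F N in sequentially. f s (real (Suc N)) x = x ^ s"
    proof eventually_elim
      case (elim N)
      then have "\<bar>x\<bar> \<le> real (Suc N)"
        by linarith
      then show ?case
        unfolding f_def by (intro arg_cong[where f="\<lambda>y. y ^ s"]) auto
    qed
  qed
  \<comment> \<open>Even clipped powers are nonnegative and increase with the clipping level, so
    monotone convergence yields integrability; other powers are then dominated by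
    \<open>1 + x ^ (2 * s)\<close>.\<close>
  have even_int: "integrable M (\<lambda>x. x ^ (2 * s))" if s: "1 \<le> s" for s
  proof (rule integral_monotone_convergence_nonneg(1)[where f="\<lambda>N. f (2 * s) (real (Suc N))" and x="m (2 * s)"])
    show "AE x in M. mono (\<lambda>N. f (2 * s) (real (Suc N)) x)"
    proof (intro AE_I2 monoI)
      fix x and A B :: nat
      assume "A \<le> B"
      then have "\<bar>max (- real (Suc A)) (min (real (Suc A)) x)\<bar> \<le> \<bar>max (- real (Suc B)) (min (real (Suc B)) x)\<bar>"
        by (auto simp: max_def min_def)
      then show "f (2 * s) (real (Suc A)) x \<le> f (2 * s) (real (Suc B)) x"
        unfolding f_def by (simp add: power_mono_even)
    qed
    show "(\<lambda>N. integral\<^sup>L M (f (2 * s) (real (Suc N)))) \<longlonglongrightarrow> m (2 * s)"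
      by (rule f_lim) (use s in simp)
    show "integrable M (f (2 * s) (real (Suc N)))" for N
      by (intro f_int M) simp
    show "AE x in M. (\<lambda>N. f (2 * s) (real (Suc N)) x) \<longlonglongrightarrow> x ^ (2 * s)"
      by (intro AE_I2 f_pt)
    show "AE x in M. 0 \<le> f (2 * s) (real (Suc N)) x" for N
      by (intro AE_I2) (simp add: f_def power_mult)
  qed simp
  show ints: "integrable M (\<lambda>x. x ^ s)" for s
  proof (cases "s = 0")
    case False
    have "\<bar>x\<bar> ^ s \<le> 1 + x ^ (2 * s)" for x :: real
    proof -
      have "0 \<le> (\<bar>x\<bar> ^ s - 1)\<^sup>2 + \<bar>x\<bar> ^ s"
        by (intro add_nonneg_nonneg) auto
      then show ?thesis
        by (simp add: power2_eq_square algebra_simps power_mult flip: power_mult_distrib)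
    qed
    then have le: "norm (x ^ s) \<le> norm (1 + x ^ (2 * s))" for x :: real
      unfolding real_norm_def power_abs using abs_ge_self order_trans by blast
    have "integrable M (\<lambda>x. 1 + x ^ (2 * s))"
      using False by (intro Bochner_Integration.integrable_add even_int) auto
    then show ?thesis
    proof (rule Bochner_Integration.integrable_bound)
      show "AE x in M. norm (x ^ s) \<le> norm (1 + x ^ (2 * s))"
        by (intro AE_I2 le)
    qed simp
  qed simp
  show "(\<integral>x. x ^ s \<partial>M) = m s"
  proof (cases "s = 0")
    case True
    have "(\<lambda>n. \<integral>x. x ^ s \<partial>\<mu> n) = (\<lambda>n. 1)"
      using True real_distribution.axioms(1)[OF \<mu>] by (simp add: prob_space.prob_space)
    then have "m s = 1"
      using lim[of s] by (simp add: LIMSEQ_const_iff)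
    then show ?thesis
      using True M.prob_space by simp
  next
    case False
    have "(\<lambda>N. \<integral>x. f s (real (Suc N)) x \<partial>M) \<longlonglongrightarrow> (\<integral>x. x ^ s \<partial>M)"
    proof (rule integral_dominated_convergence[where w="\<lambda>x. \<bar>x ^ s\<bar>"])
      show "AE x in M. (\<lambda>N. f s (real (Suc N)) x) \<longlonglongrightarrow> x ^ s"
        by (intro AE_I2 f_pt)
      show "AE x in M. norm (f s (real (Suc N)) x) \<le> \<bar>x ^ s\<bar>" for N
        using abs_power_clip_le(2)[of "real (Suc N)" _ s]
        by (intro AE_I2) (simp only: f_def real_norm_def power_abs of_nat_0_le_iff)
    qed (use ints[of s] in \<open>simp_all add: f_def\<close>)
    then show ?thesis
      using f_lim[of s] False LIMSEQ_unique by fastforce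
  qed
qed

text \<open>Up to the factor \<open>\<i> ^ s\<close>, this is the \<open>s\<close>-th derivative of the characteristic function.\<close>

definition char_moment :: "real measure \<Rightarrow> nat \<Rightarrow> real \<Rightarrow> complex" where
  "char_moment M s t = (CLINT x|M. of_real (x ^ s) * iexp (t * x))"

section \<open>Characteristic functions and determinacy by moments\<close>

context real_distribution
begin

lemma integrable_char_moment:
  assumes "\<And>s. integrable M (\<lambda>x. x ^ s)"
  shows "integrable M (\<lambda>x. of_real (x ^ s) * iexp (t * x))"
  using assms[of s]
  by (rule Bochner_Integration.integrable_bound) (auto simp: norm_mult norm_power power_abs)

text \<open>Differentiation under the integral: the pointwise remainder of
  \<open>iexp (h * x)\<close> after its linear term is at most \<open>(h * x)\<^sup>2 / 2\<close>,
  and the moment of order \<open>s + 2\<close> makes the integrated error of order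
  \<open>h\<^sup>2\<close>.\<close>

lemma char_moment_has_vector_derivative:
  assumes int: "\<And>s. integrable M (\<lambda>x. x ^ s)"
  shows "(char_moment M s has_vector_derivative \<i> * char_moment M (Suc s) t) (at t)"
proof -
  let ?C = "expectation (\<lambda>x. \<bar>x\<bar> ^ (s + 2))"
  have abs_int: "integrable M (\<lambda>x. \<bar>x\<bar> ^ s)" for s
    using int[of s] by (simp add: power_abs[symmetric])
  have bound: "norm (char_moment M s (t + h) - char_moment M s t - h *\<^sub>R (\<i> * char_moment M (Suc s) t))
      \<le> h\<^sup>2 * ?C" for h
  proof -
    let ?g = "\<lambda>x. of_real (x ^ s) * iexp ((t + h) * x) - of_real (x ^ s) * iexp (t * x)
        - of_real h * (\<i> * (of_real (x ^ Suc s) * iexp (t * x)))"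
    have "char_moment M s (t + h) - char_moment M s t - h *\<^sub>R (\<i> * char_moment M (Suc s) t)
        = (CLINT x|M. ?g x)"
      by (simp only: char_moment_def scaleR_conv_of_real Bochner_Integration.integral_diff
          Bochner_Integration.integrable_diff integrable_mult_right integral_mult_right_zero
          integrable_char_moment[OF int])
    also have "norm \<dots> \<le> expectation (\<lambda>x. h\<^sup>2 * \<bar>x\<bar> ^ (s + 2))"
    proof (rule Bochner_Integration.integral_norm_bound_integral)
      show "integrable M ?g"
        by (intro Bochner_Integration.integrable_diff integrable_mult_right integrable_char_moment int)
      show "integrable M (\<lambda>x. h\<^sup>2 * \<bar>x\<bar> ^ (s + 2))"
        by (intro integrable_mult_right abs_int)
      fix x
      have "?g x = of_real (x ^ s) * iexp (t * x) * (iexp (h * x) - (\<Sum>k\<le>1. (\<i> * (h * x)) ^ k / fact k))"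
        by (simp add: algebra_simps exp_add)
      then have "norm (?g x) = \<bar>x\<bar> ^ s * norm (iexp (h * x) - (\<Sum>k\<le>1. (\<i> * (h * x)) ^ k / fact k))"
        by (simp only: norm_mult norm_exp_i_times norm_of_real power_abs mult_1_right)
      also have "\<dots> \<le> \<bar>x\<bar> ^ s * (\<bar>h * x\<bar> ^ 2 / 2)"
        using iexp_approx1[of "h * x" 1] by (intro mult_left_mono) (simp_all add: eval_nat_numeral)
      also have "\<dots> \<le> h\<^sup>2 * \<bar>x\<bar> ^ (s + 2)"
      proof -
        have "\<bar>x\<bar> ^ s * (\<bar>h * x\<bar> ^ 2 / 2) = h\<^sup>2 * \<bar>x\<bar> ^ (s + 2) / 2"
          unfolding power_add by (simp add: power_mult_distrib)
        moreover have "0 \<le> h\<^sup>2 * \<bar>x\<bar> ^ (s + 2)"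
          by simp
        ultimately show ?thesis
          by linarith
      qed
      finally show "norm (?g x) \<le> h\<^sup>2 * \<bar>x\<bar> ^ (s + 2)" .
    qed
    finally show ?thesis
      by simp
  qed
  show ?thesis
    unfolding has_vector_derivative_def has_derivative_at
  proof (intro conjI bounded_linear_scaleR_left)
    show "(\<lambda>h. norm (char_moment M s (t + h) - char_moment M s t -
        h *\<^sub>R (\<i> * char_moment M (Suc s) t)) / norm h) \<midarrow>0\<rightarrow> 0"
    proof (rule Lim_null_comparison)
      show "(\<lambda>h. \<bar>h\<bar> * ?C) \<midarrow>0\<rightarrow> 0"
        by (auto intro!: tendsto_eq_intros)
      show "\<forall>\<^sub>F h in at 0. norm (norm (char_moment M s (t + h) - char_moment M s t -
        h *\<^sub>R (\<i> * char_moment M (Suc s) t)) / norm h) \<le> \<bar>h\<bar> * ?C"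
        unfolding eventually_at_filter
      proof (intro always_eventually allI impI)
        fix h :: real
        assume "h \<noteq> 0"
        then show "norm (norm (char_moment M s (t + h) - char_moment M s t -
            h *\<^sub>R (\<i> * char_moment M (Suc s) t)) / norm h) \<le> \<bar>h\<bar> * ?C"
          using bound[of h] by (simp add: divide_le_eq power2_eq_square mult_ac flip: abs_mult)
      qed
    qed
  qed
qed

text \<open>Factoring out \<open>iexp (t * x)\<close>, of modulus 1, moves the expansion point to 0.
  The remainder is stated with the \<open>n\<close>-th absolute moment, which for even
  \<open>n\<close> is an ordinary moment.\<close>

lemma char_moment_Taylor:
  assumes int: "\<And>s. integrable M (\<lambda>x. x ^ s)"
  shows "norm (char_moment M 0 (t + h) - (\<Sum>r\<le>n. (\<i> * h) ^ r / fact r * char_moment M r t))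
    \<le> 2 * \<bar>h\<bar> ^ n / fact n * expectation (\<lambda>x. \<bar>x\<bar> ^ n)"
proof -
  have abs_int: "integrable M (\<lambda>x. \<bar>x\<bar> ^ s)" for s
    using int[of s] by (simp add: power_abs[symmetric])
  let ?g = "\<lambda>x. of_real (x ^ 0) * iexp ((t + h) * x) -
      (\<Sum>r\<le>n. (\<i> * h) ^ r / fact r * (of_real (x ^ r) * iexp (t * x)))"
  have "char_moment M 0 (t + h) - (\<Sum>r\<le>n. (\<i> * h) ^ r / fact r * char_moment M r t) = (CLINT x|M. ?g x)"
    unfolding char_moment_def using integrable_char_moment[OF int]
    by (subst Bochner_Integration.integral_diff)
       (simp_all only: Bochner_Integration.integral_sum integrable_mult_right integral_mult_right_zero
          Bochner_Integration.integrable_sum)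
  also have "norm \<dots> \<le> expectation (\<lambda>x. 2 * \<bar>h\<bar> ^ n / fact n * \<bar>x\<bar> ^ n)"
  proof (rule Bochner_Integration.integral_norm_bound_integral)
    show "integrable M ?g"
      by (intro Bochner_Integration.integrable_diff Bochner_Integration.integrable_sum
          integrable_mult_right integrable_char_moment int)
    show "integrable M (\<lambda>x. 2 * \<bar>h\<bar> ^ n / fact n * \<bar>x\<bar> ^ n)"
      by (intro integrable_mult_right abs_int)
    fix x
    have "?g x = iexp (t * x) * (iexp (h * x) - (\<Sum>r\<le>n. (\<i> * (h * x)) ^ r / fact r))"
      by (simp add: algebra_simps exp_add sum_distrib_left power_mult_distrib)
    then have "norm (?g x) = norm (iexp (h * x) - (\<Sum>r\<le>n. (\<i> * (h * x)) ^ r / fact r))"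
      by (simp only: norm_mult norm_exp_i_times mult_1_left)
    also have "\<dots> \<le> 2 * \<bar>h * x\<bar> ^ n / fact n"
      by (rule iexp_approx2)
    finally show "norm (?g x) \<le> 2 * \<bar>h\<bar> ^ n / fact n * \<bar>x\<bar> ^ n"
      by (simp add: abs_mult power_mult_distrib)
  qed
  finally show ?thesis
    by simp
qed

end

text \<open>Both characteristic functions share their Taylor polynomials at \<open>t\<close>. At
  degree \<open>2 * r\<close> each remainder is at most twice the same quantity, hence the factor 4,
  and the growth condition sends it to 0.\<close>

lemma char_moment_extend:
  assumes M: "real_distribution M" "\<And>s. integrable M (\<lambda>x. x ^ s)"
    and N: "real_distribution N" "\<And>s. integrable N (\<lambda>x. x ^ s)"
    and eq: "\<And>s. (\<integral>x. x ^ s \<partial>M) = (\<integral>x. x ^ s \<partial>N)"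
    and growth: "(\<lambda>r. \<delta> ^ (2 * r) * (\<integral>x. x ^ (2 * r) \<partial>M) / fact (2 * r)) \<longlonglongrightarrow> 0"
    and h: "\<bar>h\<bar> \<le> \<delta>"
    and t: "\<And>r. char_moment M r t = char_moment N r t"
  shows "char_moment M 0 (t + h) = char_moment N 0 (t + h)"
proof -
  let ?S = "\<lambda>n. \<Sum>r\<le>n. (\<i> * h) ^ r / fact r * char_moment M r t"
  have "norm (char_moment M 0 (t + h) - char_moment N 0 (t + h)) \<le>
      4 * (\<delta> ^ (2 * r) * (\<integral>x. x ^ (2 * r) \<partial>M) / fact (2 * r))" for r
  proof -
    have m: "0 \<le> (\<integral>x. x ^ (2 * r) \<partial>M)"
      by (intro Bochner_Integration.integral_nonneg) (simp add: power_mult)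
    have "norm (char_moment M 0 (t + h) - char_moment N 0 (t + h)) \<le>
        norm (char_moment M 0 (t + h) - ?S (2 * r)) + norm (char_moment N 0 (t + h) - ?S (2 * r))"
      using norm_triangle_ineq4[of "char_moment M 0 (t + h) - ?S (2 * r)" "char_moment N 0 (t + h) - ?S (2 * r)"]
      by simp
    also have "\<dots> \<le> 4 * (\<bar>h\<bar> ^ (2 * r) * (\<integral>x. x ^ (2 * r) \<partial>M) / fact (2 * r))"
      using real_distribution.char_moment_Taylor[OF M, of t h "2 * r"]
        real_distribution.char_moment_Taylor[OF N, of t h "2 * r"]
      by (simp add: t eq power_even_abs)
    also have "\<dots> \<le> 4 * (\<delta> ^ (2 * r) * (\<integral>x. x ^ (2 * r) \<partial>M) / fact (2 * r))"
      using h m by (intro mult_left_mono divide_right_mono mult_right_mono power_mono) auto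
    finally show ?thesis .
  qed
  moreover have "(\<lambda>r. 4 * (\<delta> ^ (2 * r) * (\<integral>x. x ^ (2 * r) \<partial>M) / fact (2 * r))) \<longlonglongrightarrow> 0"
    using tendsto_mult_left[OF growth, of 4] by simp
  ultimately have "norm (char_moment M 0 (t + h) - char_moment N 0 (t + h)) \<le> 0"
    by (intro LIMSEQ_le_const) auto
  then show ?thesis
    by simp
qed

text \<open>The growth condition only gives a Taylor radius of at least \<open>\<delta>\<close>; equality of the
  characteristic functions is continued to the whole line in steps of length less than \<open>\<delta>\<close>.\<close>

theorem moments_determine_distribution:
  assumes M: "real_distribution M" "\<And>s. integrable M (\<lambda>x. x ^ s)"
    and N: "real_distribution N" "\<And>s. integrable N (\<lambda>x. x ^ s)"
    and eq: "\<And>s. (\<integral>x. x ^ s \<partial>M) = (\<integral>x. x ^ s \<partial>N)"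
    and growth: "(\<lambda>r. \<delta> ^ (2 * r) * (\<integral>x. x ^ (2 * r) \<partial>M) / fact (2 * r)) \<longlonglongrightarrow> 0"
    and \<delta>: "0 < \<delta>"
  shows "M = N"
proof -
  note extend = char_moment_extend[OF M N eq growth]
  have ball: "\<bar>t\<bar> < real (Suc n) * \<delta> \<Longrightarrow> char_moment M 0 t = char_moment N 0 t" for t n
  proof (induction n arbitrary: t)
    case 0
    \<comment> \<open>At 0 the exponential factor is 1, so these are the moments themselves.\<close>
    have "char_moment M r 0 = char_moment N r 0" for r
      unfolding char_moment_def using eq[of r] by (simp flip: of_real_power)
    then show ?case
      using extend[of t 0] 0 by simp
  next
    case (Suc n)
    let ?S = "{t. \<bar>t\<bar> < real (Suc n) * \<delta>}"
    have op: "open ?S"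
      by (intro open_Collect_less continuous_intros)
    \<comment> \<open>Agreement on an open set passes to derivatives, so all orders agree there by
      induction on \<open>r\<close>.\<close>
    have all: "t \<in> ?S \<Longrightarrow> char_moment M r t = char_moment N r t" for r t
    proof (induction r arbitrary: t)
      case 0
      then show ?case
        using Suc.IH by simp
    next
      case (Suc r)
      have "(char_moment N r has_vector_derivative \<i> * char_moment M (Suc r) t) (at t)"
        using Suc by (intro has_vector_derivative_transform_within_open
            [OF real_distribution.char_moment_has_vector_derivative[OF M] op]) auto
      then have "\<i> * char_moment M (Suc r) t = \<i> * char_moment N (Suc r) t"
        using real_distribution.char_moment_has_vector_derivative[OF N]
        by (rule vector_derivative_unique_at)
      then show ?case
        by simp
    qed
    \<comment> \<open>Shrinking \<open>t\<close> by the factor \<open>(n + 1) / (n + 2)\<close>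
      lands in the interval already covered, and the remaining distance
      \<open>\<bar>t\<bar> / (n + 2)\<close> is below \<open>\<delta>\<close>.\<close>
    define u where "u = t * real (Suc n) / real (Suc (Suc n))"
    have "\<bar>u\<bar> = \<bar>t\<bar> * real (Suc n) / real (Suc (Suc n))"
      unfolding u_def by (simp add: abs_mult)
    also have "\<dots> < real (Suc n) * \<delta>"
      using Suc.prems by (simp add: divide_less_eq mult_ac)
    finally have "u \<in> ?S"
      by simp
    moreover have "t - u = t / real (Suc (Suc n))"
      unfolding u_def by (simp add: field_simps)
    then have "\<bar>t - u\<bar> \<le> \<delta>"
      using Suc.prems by (simp add: divide_le_eq mult_ac)
    ultimately show ?case
      using extend[of "t - u" u] all by simp
  qed
  have "char M t = char N t" for t
  proof -
    obtain n :: nat where "\<bar>t\<bar> / \<delta> < real n"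
      using reals_Archimedean2 by blast
    then have "\<bar>t\<bar> < real (Suc n) * \<delta>"
      using \<delta> by (simp add: divide_less_eq algebra_simps)
    from ball[OF this] show ?thesis
      by (simp add: char_moment_def char_def)
  qed
  then show ?thesis
    using Levy_uniqueness[OF M(1) N(1)] by blast
qed

section \<open>Tightness and convergence of the whole sequence\<close>

lemma tight_second_moment:
  fixes \<mu> :: "nat \<Rightarrow> real measure"
  assumes \<mu>: "\<And>n. real_distribution (\<mu> n)"
    and int: "\<And>n. integrable (\<mu> n) (\<lambda>x. x ^ 2)"
    and bound: "\<And>n. (\<integral>x. x ^ 2 \<partial>\<mu> n) \<le> B"
  shows "tight \<mu>"
  unfolding tight_def
proof (intro conjI allI impI \<mu>)
  fix \<epsilon> :: real
  assume \<epsilon>: "0 < \<epsilon>"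
  \<comment> \<open>Chebyshev's inequality leaves mass at most \<open>B / K ^ 2\<close> outside.
    This \<open>K\<close> gives \<open>B < \<epsilon> * K\<close>, and \<open>1 \<le> K\<close>
    allows replacing \<open>K\<close> by \<open>K ^ 2\<close> without a square root.\<close>
  define K where "K = \<bar>B\<bar> / \<epsilon> + 1"
  have K: "1 \<le> K" "B < \<epsilon> * K"
  proof -
    have "\<epsilon> * K = \<bar>B\<bar> + \<epsilon>"
      using \<epsilon> unfolding K_def by (simp add: field_simps)
    then show "B < \<epsilon> * K"
      using \<epsilon> by linarith
  qed (use \<epsilon> in \<open>simp add: K_def\<close>)
  have "measure (\<mu> n) {- K<..K} > 1 - \<epsilon>" for n
  proof -
    interpret real_distribution "\<mu> n" by (rule \<mu>)
    have sp: "space (\<mu> n) = UNIV"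
      by simp
    have "1 - prob {- K<..K} = prob (UNIV - {- K<..K})"
      using prob_compl[of "{- K<..K}"] sp by simp
    also have "\<dots> \<le> prob {x \<in> space (\<mu> n). x ^ 2 \<ge> K ^ 2}"
    proof (rule finite_measure_mono)
      have "K ^ 2 \<le> x ^ 2" if "x \<notin> {- K<..K}" for x
        using that K(1) by (intro abs_le_square_iff[THEN iffD1]) auto
      then show "UNIV - {- K<..K} \<subseteq> {x \<in> space (\<mu> n). x ^ 2 \<ge> K ^ 2}"
        using sp by auto
    qed simp
    also have "\<dots> \<le> (\<integral>x. x ^ 2 \<partial>\<mu> n) / K ^ 2"
      using K(1) int by (intro integral_Markov_inequality_measure[where A="{}"]) auto
    also have "\<dots> \<le> B / K ^ 2"
      using bound by (intro divide_right_mono) auto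
    also have "\<dots> < \<epsilon>"
    proof -
      have "\<epsilon> * K \<le> \<epsilon> * K ^ 2"
        using \<epsilon> K(1) self_le_power[of K 2] by simp
      then show ?thesis
        using K by (subst pos_divide_less_eq) auto
    qed
    finally show ?thesis
      by linarith
  qed
  moreover have "- K < K"
    using K by simp
  ultimately show "\<exists>a b. a < b \<and> (\<forall>n. measure (\<mu> n) {a<..b} > 1 - \<epsilon>)"
    by blast
qed

text \<open>Convergent second moments are bounded, which gives tightness. Every weak subsequential
  limit has the moments \<open>m\<close>, and the growth condition makes such a law unique, so all
  subsequential limits coincide.\<close>

theorem method_of_moments:
  fixes \<mu> :: "nat \<Rightarrow> real measure"
  assumes \<mu>: "\<And>n. real_distribution (\<mu> n)"
    and int: "\<And>n s. integrable (\<mu> n) (\<lambda>x. x ^ s)"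
    and lim: "\<And>s. (\<lambda>n. \<integral>x. x ^ s \<partial>\<mu> n) \<longlonglongrightarrow> m s"
    and growth: "(\<lambda>r. \<delta> ^ (2 * r) * m (2 * r) / fact (2 * r)) \<longlonglongrightarrow> 0"
    and \<delta>: "0 < \<delta>"
  obtains M where "real_distribution M" "weak_conv_m \<mu> M"
    "\<And>s. integrable M (\<lambda>x. x ^ s)" "\<And>s. (\<integral>x. x ^ s \<partial>M) = m s"
proof -
  obtain B where "\<And>n. \<bar>\<integral>x. x ^ 2 \<partial>\<mu> n\<bar> \<le> B"
    using convergent_imp_Bseq[OF convergentI[OF lim[of 2]]] by (auto simp: Bseq_def)
  then have tight: "tight \<mu>"
    using \<mu> int by (intro tight_second_moment[of \<mu> B]) (auto simp: abs_le_iff)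
  have limits: "integrable N (\<lambda>x. x ^ s)" "(\<integral>x. x ^ s \<partial>N) = m s"
    if "strict_mono r" "real_distribution N" "weak_conv_m (\<mu> \<circ> r) N" for r N s
    using \<mu> int LIMSEQ_subseq_LIMSEQ[OF lim that(1)] that
    by (auto intro!: weak_conv_moments[of "\<mu> \<circ> r" N m] simp: o_def)
  obtain r M where M: "strict_mono r" "real_distribution M" "weak_conv_m (\<mu> \<circ> r) M"
    using tight_imp_convergent_subsubsequence[OF tight strict_mono_id] by auto
  note M_mom = limits[OF M]
  have "weak_conv_m \<mu> M"
  proof (rule tight_subseq_weak_converge[OF \<mu> M(2) tight])
    fix q N
    assume N: "strict_mono q" "real_distribution N" "weak_conv_m (\<mu> \<circ> q) N"
    note N_mom = limits[OF N]
    have "M = N"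
      using growth
      by (intro moments_determine_distribution[OF M(2) M_mom(1) N(2) N_mom(1) _ _ \<delta>])
         (simp_all add: M_mom(2) N_mom(2))
    then show "weak_conv_m (\<mu> \<circ> q) M"
      using N(3) by simp
  qed
  then show thesis
    using that M(2) M_mom by blast
qed

section \<open>Limit laws\<close>

text \<open>A rising factorial is a power plus lower-order terms, which the vanishing scale removes.
  The induction uses mixed products for all \<open>r\<close> at once, because the step from
  \<open>a\<close> to \<open>Suc a\<close> needs both \<open>r\<close> and
  \<open>Suc r\<close>.\<close>

lemma moments_from_pochhammer_moments:
  fixes p :: "nat \<Rightarrow> nat pmf" and \<sigma> :: "nat \<Rightarrow> real"
  assumes fin: "\<And>n. finite (set_pmf (p n))"
    and \<sigma>: "\<sigma> \<longlonglongrightarrow> 0"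
    and lim: "\<And>s. (\<lambda>n. \<sigma> n ^ s * measure_pmf.expectation (p n) (\<lambda>x. pochhammer (real x + 1) s)) \<longlonglongrightarrow> m s"
  shows "(\<lambda>n. \<sigma> n ^ s * measure_pmf.expectation (p n) (\<lambda>x. real x ^ s)) \<longlonglongrightarrow> m s"
proof -
  let ?E = "\<lambda>a r n. measure_pmf.expectation (p n) (\<lambda>x. real x ^ a * pochhammer (real x + 1) r)"
  \<comment> \<open>Trading one rising factor for one power at a time costs an error of order \<open>\<sigma>\<close>.\<close>
  have "(\<lambda>n. \<sigma> n ^ (a + r) * ?E a r n) \<longlonglongrightarrow> m (a + r)" for a r
  proof (induction a arbitrary: r)
    case 0
    then show ?case
      using lim[of r] by simp
  next
    case (Suc a)
    have int: "integrable (measure_pmf (p n)) f" for n and f :: "nat \<Rightarrow> real"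
      by (rule integrable_measure_pmf_finite) (rule fin)
    have E_Suc: "?E (Suc a) r n = ?E a (Suc r) n - (real r + 1) * ?E a r n" for n
    proof -
      \<comment> \<open>Write one factor \<open>x\<close> as \<open>(x + 1 + r) - (r + 1)\<close>;
        the first summand is the next rising factor.\<close>
      have "real x ^ Suc a * pochhammer (real x + 1) r =
          real x ^ a * pochhammer (real x + 1) (Suc r) - (real r + 1) * (real x ^ a * pochhammer (real x + 1) r)" for x
        unfolding pochhammer_rec' by (simp add: algebra_simps)
      then show ?thesis
        by (simp only: Bochner_Integration.integral_diff integral_mult_right_zero int)
    qed
    have "\<sigma> n ^ (Suc a + r) * ?E (Suc a) r n =
        \<sigma> n ^ (a + Suc r) * ?E a (Suc r) n - (real r + 1) * \<sigma> n * (\<sigma> n ^ (a + r) * ?E a r n)" for n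
      unfolding E_Suc by (simp add: algebra_simps)
    moreover have "(\<lambda>n. \<sigma> n ^ (a + Suc r) * ?E a (Suc r) n - (real r + 1) * \<sigma> n * (\<sigma> n ^ (a + r) * ?E a r n))
        \<longlonglongrightarrow> m (a + Suc r) - (real r + 1) * 0 * m (a + r)"
      by (intro tendsto_intros Suc.IH \<sigma>)
    ultimately show ?case
      by simp
  qed
  from this[of s 0] show ?thesis
    by simp
qed

text \<open>\<open>scaled_Y\<close> carries the discrete sigma-algebra, whereas
  \<open>real_distribution\<close> demands the Borel one. Weak convergence sees only distribution
  functions, so the Borel push-forward can replace it.\<close>

lemma cdf_scaled_Y: "cdf (scaled_Y k \<sigma> n j) = cdf (distr (measure_pmf (Y k n j)) borel (\<lambda>m. \<sigma> * real m))"
  unfolding cdf_def scaled_Y_def by (auto simp: measure_distr fun_eq_iff)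

lemma scaled_Y_method_of_moments:
  fixes jn :: "nat \<Rightarrow> nat" and \<sigma> :: "nat \<Rightarrow> real"
  assumes c: "c = real k / real (k + 1)"
    and jn: "\<forall>\<^sub>F n in sequentially. 1 \<le> jn n \<and> jn n \<le> n"
    and \<sigma>: "\<sigma> \<longlonglongrightarrow> 0"
    and lim: "\<And>s. (\<lambda>n. \<sigma> n ^ s * (fact s * shift_prod (c * (real s - 1)) (- c) (jn n) n)) \<longlonglongrightarrow> m s"
    and growth: "(\<lambda>r. \<delta> ^ (2 * r) * m (2 * r) / fact (2 * r)) \<longlonglongrightarrow> 0"
    and \<delta>: "0 < \<delta>"
  obtains M where "real_distribution M" "weak_conv_m (\<lambda>n. scaled_Y k (\<sigma> n) n (jn n)) M"
    "\<And>s. integrable M (\<lambda>x. x ^ s)" "\<And>s. (\<integral>x. x ^ s \<partial>M) = m s"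
proof -
  let ?p = "\<lambda>n. Y k n (jn n)"
  let ?\<mu> = "\<lambda>n. distr (measure_pmf (?p n)) borel (\<lambda>m. \<sigma> n * real m)"
  have pochhammer: "(\<lambda>n. \<sigma> n ^ s * measure_pmf.expectation (?p n) (\<lambda>x. pochhammer (real x + 1) s)) \<longlonglongrightarrow> m s" for s
  proof (rule Lim_transform_eventually[OF lim])
    show "\<forall>\<^sub>F n in sequentially. \<sigma> n ^ s * (fact s * shift_prod (c * (real s - 1)) (- c) (jn n) n) =
        \<sigma> n ^ s * measure_pmf.expectation (?p n) (\<lambda>x. pochhammer (real x + 1) s)"
      using jn by eventually_elim (simp add: expectation_Y_pochhammer[OF _ _ c])
  qed
  have "(\<lambda>n. \<sigma> n ^ s * measure_pmf.expectation (?p n) (\<lambda>x. real x ^ s)) \<longlonglongrightarrow> m s" for s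
    by (rule moments_from_pochhammer_moments[OF finite_set_pmf_Y \<sigma> pochhammer])
  moreover have "(\<integral>x. x ^ s \<partial>?\<mu> n) = \<sigma> n ^ s * measure_pmf.expectation (?p n) (\<lambda>x. real x ^ s)" for s n
    by (simp add: integral_distr power_mult_distrib)
  ultimately have lim': "(\<lambda>n. \<integral>x. x ^ s \<partial>?\<mu> n) \<longlonglongrightarrow> m s" for s
    by simp
  have dist: "real_distribution (?\<mu> n)" for n
    by (rule prob_space.real_distribution_distr) (auto intro: measure_pmf.prob_space_axioms)
  have int: "integrable (?\<mu> n) (\<lambda>x. x ^ s)" for n s
    by (simp add: integrable_distr_eq integrable_Y)
  obtain M where "real_distribution M" "weak_conv_m ?\<mu> M"
    "\<And>s. integrable M (\<lambda>x. x ^ s)" "\<And>s. (\<integral>x. x ^ s \<partial>M) = m s"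
    using method_of_moments[of ?\<mu> m, OF dist int lim' growth \<delta>] by blast
  then show thesis
    using that unfolding weak_conv_m_def cdf_scaled_Y by blast
qed

text \<open>Below any real bound there are only finitely many natural numbers, so the distribution
  function is a finite sum of point probabilities.\<close>

lemma pmf_tendsto_imp_weak_conv_m:
  fixes p :: "nat \<Rightarrow> nat pmf"
  assumes "\<And>m. (\<lambda>n. pmf (p n) m) \<longlonglongrightarrow> pmf q m"
  shows "weak_conv_m (\<lambda>n. measure_pmf (map_pmf real (p n))) (measure_pmf (map_pmf real q))"
  unfolding weak_conv_m_def weak_conv_def
proof (intro allI impI)
  fix x :: real
  have fin: "finite (real -` {..x})"
  proof (rule finite_subset)
    show "real -` {..x} \<subseteq> {..nat \<lfloor>x\<rfloor>}"
      by (auto simp: le_nat_floor)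
  qed simp
  show "(\<lambda>n. cdf (measure_pmf (map_pmf real (p n))) x) \<longlonglongrightarrow> cdf (measure_pmf (map_pmf real q)) x"
    unfolding cdf_def measure_map_pmf measure_measure_pmf_finite[OF fin]
    by (intro tendsto_sum assms)
qed

text \<open>The \<open>l\<close>-th product tends to \<open>\<rho> powr (c * (1 + l))\<close>, and
  the binomial theorem collapses the alternating sum. The value \<open>\<rho> = 1\<close> is
  included and serves the regime \<open>n - j = o(n)\<close>.\<close>

lemma pmf_Y_geometric_limit:
  fixes jn :: "nat \<Rightarrow> nat"
  assumes c: "c = real k / real (k + 1)"
    and jn: "filterlim jn at_top sequentially" "\<forall>\<^sub>F n in sequentially. jn n \<le> n"
    and \<rho>: "(\<lambda>n. real (jn n) / real n) \<longlonglongrightarrow> \<rho>" "0 < \<rho>"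
  shows "(\<lambda>n. pmf (Y k n (jn n)) m) \<longlonglongrightarrow> \<rho> powr c * (1 - \<rho> powr c) ^ m"
proof -
  let ?q = "\<rho> powr c"
  have pos: "\<forall>\<^sub>F n in sequentially. 1 \<le> jn n"
    using jn(1) by (simp add: filterlim_at_top)
  have shift: "(\<lambda>n. shift_prod (- (c * (2 + real l))) (- c) (jn n) n) \<longlonglongrightarrow> ?q * ?q ^ l" for l
  proof -
    let ?r = "\<lambda>n. real (jn n) / real n" and ?e = "c * (1 + real l)"
    have lim: "(\<lambda>n. shift_prod (- (c * (2 + real l))) (- c) (jn n) n * ?r n powr (- (c * (2 + real l)) - (- c)) * ?r n powr ?e)
        \<longlonglongrightarrow> 1 * \<rho> powr ?e"
      using \<rho> by (intro tendsto_mult shift_prod_asymp jn tendsto_powr tendsto_const) auto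
    have eq: "\<forall>\<^sub>F n in sequentially. shift_prod (- (c * (2 + real l))) (- c) (jn n) n *
        ?r n powr (- (c * (2 + real l)) - (- c)) * ?r n powr ?e = shift_prod (- (c * (2 + real l))) (- c) (jn n) n"
      using pos jn(2)
    proof eventually_elim
      case (elim n)
      then have "0 < ?r n"
        by simp
      moreover have "- (c * (2 + real l)) - (- c) + ?e = 0"
        by (simp add: algebra_simps)
      ultimately show ?case
        using elim unfolding mult.assoc powr_add[symmetric] by simp
    qed
    have "\<rho> powr ?e = ?q * ?q ^ l"
      using \<rho>(2) by (simp add: powr_power powr_add[symmetric] algebra_simps)
    then show ?thesis
      using Lim_transform_eventually[OF lim eq] by simp
  qed
  have "(\<lambda>n. \<Sum>l\<le>m. real (m choose l) * (-1) ^ l * shift_prod (- (c * (2 + real l))) (- c) (jn n) n) \<longlonglongrightarrow>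
      (\<Sum>l\<le>m. real (m choose l) * (-1) ^ l * (?q * ?q ^ l))"
    by (intro tendsto_intros shift)
  moreover have "\<forall>\<^sub>F n in sequentially.
      (\<Sum>l\<le>m. real (m choose l) * (-1) ^ l * shift_prod (- (c * (2 + real l))) (- c) (jn n) n) = pmf (Y k n (jn n)) m"
    using pos jn(2) by eventually_elim (rule pmf_Y_shift_prod[OF _ _ c, symmetric])
  moreover have "(\<Sum>l\<le>m. real (m choose l) * (-1) ^ l * (?q * ?q ^ l)) = ?q * (1 - ?q) ^ m"
  proof -
    have "(\<Sum>l\<le>m. real (m choose l) * (-1) ^ l * (?q * ?q ^ l)) =
        ?q * (\<Sum>l\<le>m. real (m choose l) * (- ?q) ^ l * 1 ^ (m - l))"
      unfolding sum_distrib_left power_minus[of ?q] by (intro sum.cong refl) (simp add: mult_ac)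
    also have "\<dots> = ?q * (1 - ?q) ^ m"
      unfolding binomial_ring[symmetric] by simp
    finally show ?thesis .
  qed
  ultimately show ?thesis
    by (simp add: tendsto_cong)
qed

lemma real_distribution_exponential: "real_distribution (density lborel (exponential_density 1))"
  by (simp add: real_distribution_def real_distribution_axioms_def prob_space_exponential_density)

text \<open>The exponential law is the Erlang law with index 0, whose moments are known.\<close>

lemma exponential_moments:
  "has_bochner_integral (density lborel (exponential_density 1)) (\<lambda>x. x ^ s) (fact s)"
proof -
  let ?M = "density lborel (exponential_density 1)"
  interpret prob_space ?M
    by (rule prob_space_exponential_density) simp
  have "distributed ?M lborel (\<lambda>x. x) (exponential_density 1)"
    unfolding distributed_def by (auto intro!: distr_id2)
  from has_bochner_integral_erlang_ith_moment[OF _ this, of s] show ?thesis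
    by simp
qed

section \<open>The individual limit regimes\<close>

theorem scaled_Y_fixed_limit:
  assumes k: "k \<ge> 1" and c: "c = real k / real (k + 1)" and j: "j \<ge> 1"
  shows "\<exists>\<mu>. real_distribution \<mu> \<and>
        weak_conv_m (\<lambda>n. scaled_Y k (real n powr (- c)) n j) \<mu> \<and>
        (\<forall>s::nat. integrable \<mu> (\<lambda>x. x ^ s) \<and>
           (\<integral>x. x ^ s \<partial>\<mu>) = fact s * Gamma (real j + 1 - c) / Gamma (real j + 1 + c * (real s - 1))) \<and>
        (\<forall>\<nu>. real_distribution \<nu> \<and>
             (\<forall>s::nat. integrable \<nu> (\<lambda>x. x ^ s) \<and> (\<integral>x. x ^ s \<partial>\<nu>) = (\<integral>x. x ^ s \<partial>\<mu>))
             \<longrightarrow> \<nu> = \<mu>)"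
proof -
  have c_bounds: "1 / 2 \<le> c" "c < 1"
    using k unfolding c by (auto simp: field_simps)
  define m :: "nat \<Rightarrow> real" where
    "m s = fact s * Gamma (real j + 1 - c) / Gamma (real j + 1 + c * (real s - 1))" for s
  have growth: "(\<lambda>r. (1 / 2) ^ (2 * r) * m (2 * r) / fact (2 * r)) \<longlonglongrightarrow> 0"
  proof (rule Lim_null_comparison)
    \<comment> \<open>Gamma increases from \<open>3 / 2\<close> on, and for \<open>1 \<le> r\<close>
      the argument in the denominator of \<open>m (2 * r)\<close> is at least \<open>j + 1\<close>.
      Hence \<open>m (2 * r) / fact (2 * r)\<close> is at most \<open>?B\<close>, and
      \<open>\<delta> = 1 / 2\<close> leaves a geometric sequence.\<close>
    let ?B = "Gamma (real j + 1 - c) / Gamma (3 / 2)"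
    have G: "Gamma (real j + 1 - c) > 0"
      using c_bounds by (intro Gamma_real_pos) simp
    show "\<forall>\<^sub>F r in sequentially. norm ((1 / 2) ^ (2 * r) * m (2 * r) / fact (2 * r)) \<le> ?B * (1 / 4) ^ r"
      using eventually_ge_at_top[of 1]
    proof eventually_elim
      case (elim r)
      have "0 \<le> c * (real (2 * r) - 1)"
        using elim c_bounds by simp
      then have less: "Gamma (3 / 2) < Gamma (real j + 1 + c * (real (2 * r) - 1))"
        using j by (intro Gamma_real_strict_mono) auto
      have G': "0 < Gamma (3 / 2 :: real)"
        by (rule Gamma_real_pos) simp
      have "Gamma (real j + 1 - c) / Gamma (real j + 1 + c * (real (2 * r) - 1)) \<le> ?B"
        using G G' less by (intro divide_left_mono mult_pos_pos) linarith+
      moreover have "0 \<le> Gamma (real j + 1 - c) / Gamma (real j + 1 + c * (real (2 * r) - 1))"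
        using G G' less by (intro divide_nonneg_nonneg) linarith+
      moreover have eq: "(1 / 2) ^ (2 * r) * m (2 * r) / fact (2 * r) =
          Gamma (real j + 1 - c) / Gamma (real j + 1 + c * (real (2 * r) - 1)) * (1 / 4) ^ r"
        unfolding m_def by (simp add: power_mult power_divide)
      moreover have "norm (x * (1 / 4) ^ r) \<le> y * (1 / 4) ^ r" if "x \<le> y" "0 \<le> x" for x y :: real
        using that by (simp add: abs_mult mult_right_mono)
      ultimately show ?case
        unfolding eq by blast
    qed
    have "(\<lambda>r. (1 / 4) ^ r) \<longlonglongrightarrow> (0 :: real)"
      by (intro LIMSEQ_power_zero) simp
    from tendsto_mult_left[OF this, of ?B] show "(\<lambda>r. ?B * (1 / 4) ^ r) \<longlonglongrightarrow> 0"
      by simp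
  qed
  have lim: "(\<lambda>n. (real n powr (- c)) ^ s * (fact s * shift_prod (c * (real s - 1)) (- c) j n)) \<longlonglongrightarrow> m s" for s
  proof -
    have pos: "0 < real j + 1 + c * (real s - 1)"
    proof -
      have "0 \<le> c * real s"
        using c_bounds by simp
      then show ?thesis
        using c_bounds unfolding right_diff_distrib by linarith
    qed
    have "(\<lambda>n. fact s * (shift_prod (c * (real s - 1)) (- c) j n * real n powr (- c - c * (real s - 1)))) \<longlonglongrightarrow>
        fact s * (Gamma (real j + 1 + - c) / Gamma (real j + 1 + c * (real s - 1)))"
      using pos c_bounds by (intro tendsto_mult_left shift_prod_asymp_fixed) auto
    then have "(\<lambda>n. fact s * (shift_prod (c * (real s - 1)) (- c) j n * real n powr (- c - c * (real s - 1)))) \<longlonglongrightarrow> m s"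
      by (simp add: m_def)
    moreover have "\<forall>\<^sub>F n in sequentially. fact s * (shift_prod (c * (real s - 1)) (- c) j n * real n powr (- c - c * (real s - 1))) =
        (real n powr (- c)) ^ s * (fact s * shift_prod (c * (real s - 1)) (- c) j n)"
      using eventually_gt_at_top[of 0]
    proof eventually_elim
      case (elim n)
      have "- c - c * (real s - 1) = real s * - c"
        by (simp add: algebra_simps)
      then show ?case
        using elim by (simp add: powr_power)
    qed
    ultimately show ?thesis
      by (rule Lim_transform_eventually)
  qed
  have \<sigma>: "(\<lambda>n. real n powr (- c)) \<longlonglongrightarrow> 0"
    using c_bounds by (intro tendsto_neg_powr filterlim_real_sequentially) auto
  have jn: "\<forall>\<^sub>F n in sequentially. 1 \<le> j \<and> j \<le> n"
    using eventually_ge_at_top[of j] j by simp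
  obtain M where M: "real_distribution M" "weak_conv_m (\<lambda>n. scaled_Y k (real n powr (- c)) n j) M"
    "\<And>s. integrable M (\<lambda>x. x ^ s)" "\<And>s. (\<integral>x. x ^ s \<partial>M) = m s"
    using scaled_Y_method_of_moments[OF c jn \<sigma> lim growth] by auto
  moreover have "N = M" if "real_distribution N"
    "\<And>s. integrable N (\<lambda>x. x ^ s)" "\<And>s. (\<integral>x. x ^ s \<partial>N) = (\<integral>x. x ^ s \<partial>M)" for N
    using moments_determine_distribution[OF M(1,3) that(1,2), of "1 / 2"] that(3) growth M(4) by simp
  ultimately show ?thesis
    unfolding m_def by blast
qed

text \<open>The scale \<open>(jn n / n) powr c\<close> cancels the power in the product asymptotics
  exactly, leaving the moments \<open>fact s\<close>. Their growth determines the law, so the limit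
  must be the exponential one.\<close>

theorem scaled_Y_exponential_limit:
  fixes jn :: "nat \<Rightarrow> nat"
  assumes k: "k \<ge> 1" and c: "c = real k / real (k + 1)"
    and jn: "filterlim jn at_top sequentially"
    and ratio: "(\<lambda>n. real (jn n) / real n) \<longlonglongrightarrow> 0"
  shows "weak_conv_m (\<lambda>n. scaled_Y k ((real (jn n) / real n) powr c) n (jn n))
                    (density lborel (exponential_density 1))"
proof -
  let ?r = "\<lambda>n. real (jn n) / real n"
  have c_pos: "0 < c"
    using k unfolding c by simp
  have ev: "\<forall>\<^sub>F n in sequentially. 1 \<le> jn n \<and> jn n \<le> n"
  proof -
    have "\<forall>\<^sub>F n in sequentially. ?r n < 1"
      using order_tendstoD(2)[OF ratio] by simp
    moreover have "\<forall>\<^sub>F n in sequentially. 1 \<le> jn n"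
      using jn by (simp add: filterlim_at_top)
    ultimately show ?thesis
      using eventually_gt_at_top[of 0] by eventually_elim (simp add: divide_less_eq)
  qed
  have growth: "(\<lambda>r. (1 / 2) ^ (2 * r) * fact (2 * r) / fact (2 * r)) \<longlonglongrightarrow> (0 :: real)"
  proof -
    have "(\<lambda>r. (1 / 4 :: real) ^ r) \<longlonglongrightarrow> 0"
      by (intro LIMSEQ_power_zero) simp
    moreover have "(1 / 2) ^ (2 * r) * fact (2 * r) / fact (2 * r) = (1 / 4 :: real) ^ r" for r
      by (simp add: power_mult power_divide)
    ultimately show ?thesis
      by (simp only:)
  qed
  have lim: "(\<lambda>n. (?r n powr c) ^ s * (fact s * shift_prod (c * (real s - 1)) (- c) (jn n) n)) \<longlonglongrightarrow> fact s" for s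
  proof -
    have "(\<lambda>n. fact s * (shift_prod (c * (real s - 1)) (- c) (jn n) n * ?r n powr (c * (real s - 1) - (- c)))) \<longlonglongrightarrow> fact s * 1"
      using ev by (intro tendsto_mult_left shift_prod_asymp jn) (auto elim: eventually_mono)
    moreover have "\<forall>\<^sub>F n in sequentially. fact s * (shift_prod (c * (real s - 1)) (- c) (jn n) n * ?r n powr (c * (real s - 1) - (- c))) =
        (?r n powr c) ^ s * (fact s * shift_prod (c * (real s - 1)) (- c) (jn n) n)"
      using ev
    proof eventually_elim
      case (elim n)
      have "c * (real s - 1) - (- c) = real s * c"
        by (simp add: algebra_simps)
      moreover have "?r n \<noteq> 0"
        using elim by simp
      ultimately show ?case
        by (simp add: powr_power)
    qed
    ultimately have "(\<lambda>n. (?r n powr c) ^ s * (fact s * shift_prod (c * (real s - 1)) (- c) (jn n) n)) \<longlonglongrightarrow> fact s * 1"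
      by (rule Lim_transform_eventually)
    then show ?thesis
      by simp
  qed
  have \<sigma>: "(\<lambda>n. ?r n powr c) \<longlonglongrightarrow> 0"
    using c_pos by (intro tendsto_zero_powrI[OF ratio tendsto_const]) auto
  obtain M where M: "real_distribution M" "weak_conv_m (\<lambda>n. scaled_Y k (?r n powr c) n (jn n)) M"
    "\<And>s. integrable M (\<lambda>x. x ^ s)" "\<And>s. (\<integral>x. x ^ s \<partial>M) = fact s"
    using scaled_Y_method_of_moments[OF c ev \<sigma> lim growth] by auto
  note exp = exponential_moments[THEN integrable.intros] exponential_moments[THEN has_bochner_integral_integral_eq]
  have "M = density lborel (exponential_density 1)"
    using moments_determine_distribution[OF M(1,3) real_distribution_exponential exp(1), of "1 / 2"] growth
    by (simp add: M(4) exp(2))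
  then show ?thesis
    using M(2) by simp
qed

theorem theorem1:
  fixes k :: nat
  assumes k: "k \<ge> 1"
  defines "c \<equiv> real k / real (k + 1)"
  shows
    "(\<forall>n j m. 1 \<le> j \<and> j \<le> n \<longrightarrow>
        pmf (Y k n j) m =
          ((real j - c) gchoose j) / (((real n - c) gchoose n) * real (n choose j)) *
          (\<Sum>l=0..m. real (m choose l) * (-1) ^ l *
             ((real n - real k * (2 + real l) / real (k + 1)) gchoose (n - j))))
   \<and> (\<forall>j\<ge>1. \<exists>\<mu>. real_distribution \<mu> \<and>
        weak_conv_m (\<lambda>n. scaled_Y k (real n powr (- c)) n j) \<mu> \<and>
        (\<forall>s::nat. integrable \<mu> (\<lambda>x. x ^ s) \<and>
           (\<integral>x. x ^ s \<partial>\<mu>) = fact s * Gamma (real j + 1 / real (k + 1)) /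
                              Gamma (real j + 1 + real k * (real s - 1) / real (k + 1))) \<and>
        (\<forall>\<nu>. real_distribution \<nu> \<and>
             (\<forall>s::nat. integrable \<nu> (\<lambda>x. x ^ s) \<and> (\<integral>x. x ^ s \<partial>\<nu>) = (\<integral>x. x ^ s \<partial>\<mu>))
             \<longrightarrow> \<nu> = \<mu>))
   \<and> (\<forall>jn :: nat \<Rightarrow> nat. filterlim jn at_top sequentially \<and>
        (\<lambda>n. real (jn n) / real n) \<longlonglongrightarrow> 0 \<longrightarrow>
        weak_conv_m (\<lambda>n. scaled_Y k ((real (jn n) / real n) powr c) n (jn n))
                    (density lborel (exponential_density 1)))
   \<and> (\<forall>(jn :: nat \<Rightarrow> nat) (\<rho>::real). 0 < \<rho> \<and> \<rho> < 1 \<and> filterlim jn at_top sequentially \<and>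
        (\<lambda>n. real (jn n) / real n) \<longlonglongrightarrow> \<rho> \<longrightarrow>
        weak_conv_m (\<lambda>n. scaled_Y k 1 n (jn n))
                    (measure_pmf (map_pmf real (geometric_pmf (\<rho> powr c)))))
   \<and> (\<forall>jn :: nat \<Rightarrow> nat. filterlim jn at_top sequentially \<and>
        (\<forall>\<^sub>F n in sequentially. jn n \<le> n) \<and>
        (\<lambda>n. real (n - jn n) / real n) \<longlonglongrightarrow> 0 \<longrightarrow>
        (\<lambda>n. pmf (Y k n (jn n)) 0) \<longlonglongrightarrow> 1)"
proof -
  have c: "c = real k / real (k + 1)"
    unfolding c_def ..
  have c_bounds: "0 < c" "c < 1"
    using k unfolding c by auto
  have "pmf (Y k n j) m =
          ((real j - c) gchoose j) / (((real n - c) gchoose n) * real (n choose j)) *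
          (\<Sum>l=0..m. real (m choose l) * (-1) ^ l *
             ((real n - real k * (2 + real l) / real (k + 1)) gchoose (n - j)))"
    if "1 \<le> j" "j \<le> n" for n j m
  proof -
    have "c * (2 + real l) = real k * (2 + real l) / real (k + 1)" for l
      unfolding c by simp
    then show ?thesis
      unfolding pmf_Y_shift_prod[OF that c] shift_prod_gchoose[OF that(2) c_bounds(2)]
      by (simp only: sum_distrib_left atLeast0AtMost mult_ac)
  qed
  moreover have "\<exists>\<mu>. real_distribution \<mu> \<and>
        weak_conv_m (\<lambda>n. scaled_Y k (real n powr (- c)) n j) \<mu> \<and>
        (\<forall>s::nat. integrable \<mu> (\<lambda>x. x ^ s) \<and>
           (\<integral>x. x ^ s \<partial>\<mu>) = fact s * Gamma (real j + 1 / real (k + 1)) /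
                              Gamma (real j + 1 + real k * (real s - 1) / real (k + 1))) \<and>
        (\<forall>\<nu>. real_distribution \<nu> \<and>
             (\<forall>s::nat. integrable \<nu> (\<lambda>x. x ^ s) \<and> (\<integral>x. x ^ s \<partial>\<nu>) = (\<integral>x. x ^ s \<partial>\<mu>))
             \<longrightarrow> \<nu> = \<mu>)" if "j \<ge> 1" for j
  proof -
    have e1: "real j + 1 / real (k + 1) = real j + 1 - c"
      unfolding c by (simp add: field_simps)
    have e2: "real k * (real s - 1) / real (k + 1) = c * (real s - 1)" for s
      unfolding c by simp
    show ?thesis
      unfolding e1 e2 by (rule scaled_Y_fixed_limit[OF k c that])
  qed
  moreover have "weak_conv_m (\<lambda>n. scaled_Y k 1 n (jn n))
                    (measure_pmf (map_pmf real (geometric_pmf (\<rho> powr c))))"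
    if \<rho>: "0 < \<rho>" "\<rho> < 1" and jn: "filterlim jn at_top sequentially"
      and ratio: "(\<lambda>n. real (jn n) / real n) \<longlonglongrightarrow> \<rho>" for jn \<rho>
  proof -
    have le: "\<forall>\<^sub>F n in sequentially. jn n \<le> n"
      using order_tendstoD(2)[OF ratio \<rho>(2)] eventually_gt_at_top[of 0]
      by eventually_elim (simp add: divide_less_eq)
    \<comment> \<open>These bounds make \<open>\<rho> powr c\<close> an admissible parameter of the
      geometric law.\<close>
    have "0 < \<rho> powr c" "\<rho> powr c \<le> 1"
      using \<rho> c_bounds by (auto intro: powr_le1)
    then have "(\<lambda>n. pmf (Y k n (jn n)) m) \<longlonglongrightarrow> pmf (geometric_pmf (\<rho> powr c)) m" for m
      using pmf_Y_geometric_limit[OF c jn le ratio \<rho>(1), of m] by (simp add: mult.commute)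
    from pmf_tendsto_imp_weak_conv_m[OF this] show ?thesis
      unfolding scaled_Y_def by simp
  qed
  moreover have "(\<lambda>n. pmf (Y k n (jn n)) 0) \<longlonglongrightarrow> 1"
    if jn: "filterlim jn at_top sequentially" and le: "\<forall>\<^sub>F n in sequentially. jn n \<le> n"
      and ratio: "(\<lambda>n. real (n - jn n) / real n) \<longlonglongrightarrow> 0" for jn
  proof -
    have "(\<lambda>n. 1 - real (n - jn n) / real n) \<longlonglongrightarrow> 1 - 0"
      by (intro tendsto_intros ratio)
    moreover have "\<forall>\<^sub>F n in sequentially. 1 - real (n - jn n) / real n = real (jn n) / real n"
      using le eventually_gt_at_top[of 0] by eventually_elim (simp add: of_nat_diff field_simps)
    ultimately have "(\<lambda>n. real (jn n) / real n) \<longlonglongrightarrow> 1"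
      by (simp add: tendsto_cong)
    \<comment> \<open>Here \<open>\<rho> = 1\<close> and \<open>m = 0\<close>, so the limit
      \<open>1 powr c * 0 ^ 0\<close> equals 1.\<close>
    from pmf_Y_geometric_limit[OF c jn le this, of 0] show ?thesis
      by simp
  qed
  ultimately show ?thesis
    using scaled_Y_exponential_limit[OF k c] by blast
qed

end
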